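(* Let the network, the costs $f_1,\dots,f_N$, the noise density $p$, the nonlinearity $\Psi$ and the initial point $\mathbf{x}^0\in\mathbb{R}^{MN}$ satisfy the assumptions listed in the context. Then there are constants $c_1'>0$ and $G>0$ satisfying (i) $|\varphi(u)|\le c_1'$ for all $u\in\mathbb{R}$, and (ii) $|\varphi(u)|\ge \frac{\varphi'(0)\,G\,|u|}{2g}$ for all $g\ge G$ and all $0<|u|<g$, such that the following holds for all $a,b>0$ and $\delta\in(1/2,1)$. Let $\{\mathbf{x}^t\}$ be generated by the algorithm of the context with $\alpha_t=a/(t+1)$, $\beta_t=b/(t+1)^\delta$. Let $$\tilde c=\max\left(\|\mathbf{x}^0-\boldsymbol{\theta}^\star\|+2c_1'\,b\,\frac{(t_0^{\mathrm{mse}})^{1-\delta}}{1-\delta},\ \frac{4\|\nabla F(\boldsymbol{\theta}^\star)\|^2}{\mu^2}+\mathbb{E}\big[\|\mathbf{x}^{t_0^{\mathrm{mse}}}-\boldsymbol{\theta}^\star\|^2\big]\right),$$ where $t_0^{\mathrm{mse}}\ge 0$ is an integer for which $\mathbb{E}[\|\mathbf{x}^t-\boldsymbol{\theta}^\star\|^2]\le\tilde c$ for all $t=0,1,\dots$ (such an integer exists). Then $$\limsup_{t\to\infty}\mathbb{E}\big[\|\mathbf{x}^t-\mathbf{1}_N\otimes\mathbf{x}^\star\|^2\big]\le \frac{256\,a^2\,{c_1'}^2(MN-1)\left(L\tilde c+\|\nabla F(\boldsymbol{\theta}^\star)\|^2\right)}{\big((1-\delta)\varphi'(0)G\big)^2}\left(1+4\frac{L}{\mu}\right).$$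 Moreover, $$\mathbb{E}\big[\|\mathbf{x}^t-\mathbf{1}_N\otimes\mathbf{x}^\star\|^2\big]\le \frac{256\,a^2\,{c_1'}^2(MN-1)\left(L\tilde c+\|\nabla F(\boldsymbol{\theta}^\star)\|^2\right)}{\big((1-\delta)\varphi'(0)G\big)^2}\left(1+4\frac{L}{\mu}\right)+O\left(\frac{1}{t^{\gamma}}\right),$$ where $\gamma=\min\left(\frac{\varphi'(0)\,G\,(1-\delta)}{4c_1'},\,a\mu\right)$.
   Context: Network: $N$ agents form the vertex set $V=\{1,\dots,N\}$ of an undirected, simple, connected, static graph $(V,E)$. $\Omega_i=\{j:\{i,j\}\in E\}$ is the set of neighbors of $i$. The set of arcs $E_d$ contains both $(i,j)$ and $(j,i)$ for every $\{i,j\}\in E$. Costs: for each $i$, $f_i:\mathbb{R}^M\to\mathbb{R}$ is twice continuously differentiable with $\mu\mathbf{I}\preceq\nabla^2 f_i(\mathbf{x})\preceq L\mathbf{I}$ for all $\mathbf{x}\in\mathbb{R}^M$, where $0<\mu\le L<\infty$. $\mathbf{x}^\star\in\mathbb{R}^M$ is the unique minimizer of $f=\sum_{i=1}^N f_i$. For $\mathbf{x}=[\mathbf{x}_1,\dots,\mathbf{x}_N]\in\mathbb{R}^{MN}$ with $\mathbf{x}_i\in\mathbb{R}^M$, $F(\mathbf{x})=\sum_{i=1}^N f_i(\mathbf{x}_i)$, and $\boldsymbol{\theta}^\star=\mathbf{1}_N\otimes\mathbf{x}^\star\in\mathbb{R}^{MN}$. Communication noise: random vectors $\boldsymbol{\xi}_{ij}^t\in\mathbb{R}^M$,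 $(i,j)\in E_d$, $t=0,1,\dots$, i.i.d. in $t$ and independent across different arcs. Each entry $[\boldsymbol{\xi}_{ij}^t]_\ell$ has the same probability density $p$, where $p(u)=p(-u)$ for all $u$, $p(u)>0$ for $|u|\le c$ for some $c>0$, and $\int|u|p(u)\,du<\infty$. (The variance may be infinite.) Nonlinearity: $\Psi:\mathbb{R}\to\mathbb{R}$ is odd, $\Psi(u)>0$ for $u>0$, nondecreasing, bounded ($|\Psi|\le c_1$ for some $c_1>0$), continuous and differentiable on $\mathbb{R}$ with $|\Psi'|\le c_2$ for some $c_2>0$. $\boldsymbol{\Psi}:\mathbb{R}^M\to\mathbb{R}^M$ applies $\Psi$ componentwise. Define $\varphi(u)=\int\Psi(u+w)p(w)\,dw$, $u\in\mathbb{R}$; $\varphi$ is differentiable with $\varphi'(0)>0$. Algorithm: from a deterministic $\mathbf{x}^0\in\mathbb{R}^{MN}$, for $t=0,1,\dots$ and $i=1,\dots,N$, $$\mathbf{x}_i^{t+1}=\mathbf{x}_i^t-\beta_t\sum_{j\in\Omega_i}\boldsymbol{\Psi}\left(\mathbf{x}_i^t-\mathbf{x}_j^t+\boldsymbol{\xi}_{ij}^t\right)-\alpha_t\nabla f_i(\mathbf{x}_i^t),$$ and $\mathbf{x}^t=[\mathbf{x}_1^t,\dots,\mathbf{x}_N^t]\in\mathbb{R}^{MN}$. $\|\cdot\|$ is the Euclidean norm. *)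

theory Defs
  imports "HOL-Probability.Probability" "HOL-Library.Landau_Symbols"
begin

definition grad :: "('a::real_inner \<Rightarrow> real) \<Rightarrow> 'a \<Rightarrow> 'a" where
  "grad f x = (THE D. GDERIV f x :> D)"

lemma grad_eqI:
  assumes "GDERIV f x :> D"
  shows "grad f x = D"
  unfolding grad_def
proof (rule the_equality)
  fix D' assume "GDERIV f x :> D'"
  then have "(\<lambda>h. inner h D') = (\<lambda>h. inner h D)"
    using assms by (auto simp: gderiv_def intro: has_derivative_unique)
  then have "inner (D' - D) D' = inner (D' - D) D"
    by meson
  then show "D' = D"
    by (metis inner_diff_right inner_eq_zero_iff right_minus_eq)
qed (fact assms)

definition hessian :: "(real^'m \<Rightarrow> real) \<Rightarrow> real^'m \<Rightarrow> real^'m^'m" where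
  "hessian f x = jacobian (grad f) (at x)"

definition twice_cont_differentiable :: "(real^'m \<Rightarrow> real) \<Rightarrow> bool" where
  "twice_cont_differentiable f \<longleftrightarrow>
     (\<forall>x. f differentiable (at x)) \<and>
     (\<forall>x. grad f differentiable (at x)) \<and>
     continuous_on UNIV (hessian f)"

definition pos_semidef :: "real^'m^'m \<Rightarrow> bool" where
  "pos_semidef A \<longleftrightarrow> transpose A = A \<and> (\<forall>v. 0 \<le> inner v (A *v v))"

definition loewner_le :: "real^'m^'m \<Rightarrow> real^'m^'m \<Rightarrow> bool" where
  "loewner_le A B \<longleftrightarrow> pos_semidef (B - A)"

text \<open>The vertex set is the whole (finite) type; an edge is a two-element set of vertices.\<close>

definition neighbors :: "'n set set \<Rightarrow> 'n \<Rightarrow> 'n set" where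
  "neighbors E i = {j. {i, j} \<in> E}"

definition arcs :: "'n set set \<Rightarrow> ('n \<times> 'n) set" where
  "arcs E = {(i, j). {i, j} \<in> E}"

definition simple_graph :: "'n set set \<Rightarrow> bool" where
  "simple_graph E \<longleftrightarrow> (\<forall>e\<in>E. card e = 2)"

definition connected_graph :: "'n set set \<Rightarrow> bool" where
  "connected_graph E \<longleftrightarrow> (\<forall>i j. (i, j) \<in> (arcs E)\<^sup>*)"

definition symmetric_noise_density :: "(real \<Rightarrow> real) \<Rightarrow> bool" where
  "symmetric_noise_density p \<longleftrightarrow>
     p \<in> borel_measurable borel \<and> (\<forall>u. 0 \<le> p u) \<and> (\<integral>\<^sup>+ u. ennreal (p u) \<partial>lborel) = 1 \<and>
     (\<forall>u. p u = p (- u)) \<and>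
     (\<exists>c>0. \<forall>u. \<bar>u\<bar> \<le> c \<longrightarrow> 0 < p u) \<and>
     integrable lborel (\<lambda>u. \<bar>u\<bar> * p u)"

text \<open>Independence is joint over all times and arcs. The entries of a single noise vector may be
  dependent on each other; only their marginal density is prescribed.\<close>

definition iid_noise ::
    "'p measure \<Rightarrow> 'e set \<Rightarrow> (real \<Rightarrow> real) \<Rightarrow> (nat \<Rightarrow> 'e \<Rightarrow> 'p \<Rightarrow> real^'m) \<Rightarrow> bool" where
  "iid_noise M A p \<xi> \<longleftrightarrow>
     prob_space M \<and>
     prob_space.indep_vars M (\<lambda>_. borel) (\<lambda>(t, e). \<xi> t e) (UNIV \<times> A) \<and>
     (\<forall>e\<in>A. \<forall>s t. distr M borel (\<xi> s e) = distr M borel (\<xi> t e)) \<and>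
     (\<forall>t. \<forall>e\<in>A. \<forall>l. distributed M lborel (\<lambda>\<omega>. \<xi> t e \<omega> $ l) (\<lambda>u. ennreal (p u)))"

definition admissible_nonlinearity :: "(real \<Rightarrow> real) \<Rightarrow> bool" where
  "admissible_nonlinearity \<Psi> \<longleftrightarrow>
     (\<forall>u. \<Psi> (- u) = - \<Psi> u) \<and> (\<forall>u>0. 0 < \<Psi> u) \<and> mono \<Psi> \<and>
     (\<exists>c1>0. \<forall>u. \<bar>\<Psi> u\<bar> \<le> c1) \<and>
     continuous_on UNIV \<Psi> \<and> (\<forall>u. \<Psi> differentiable (at u)) \<and>
     (\<exists>c2>0. \<forall>u. \<bar>deriv \<Psi> u\<bar> \<le> c2)"

definition phi :: "(real \<Rightarrow> real) \<Rightarrow> (real \<Rightarrow> real) \<Rightarrow> real \<Rightarrow> real" where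
  "phi \<Psi> p u = (LINT w|lborel. \<Psi> (u + w) * p w)"

definition componentwise :: "(real \<Rightarrow> real) \<Rightarrow> real^'m \<Rightarrow> real^'m" where
  "componentwise \<Psi> v = (\<chi> l. \<Psi> (v $ l))"

text \<open>The stacked vectors of \<open>CARD('n)\<close> blocks of size \<open>CARD('m)\<close> have type \<open>real^'m^'n\<close>, whose norm is
  the Euclidean norm over all entries.\<close>

definition stacked_cost :: "('n::finite \<Rightarrow> real^'m \<Rightarrow> real) \<Rightarrow> real^'m^'n \<Rightarrow> real" where
  "stacked_cost f x = (\<Sum>i\<in>UNIV. f i (x $ i))"

primrec iterate ::
    "'n set set \<Rightarrow> ('n::finite \<Rightarrow> real^'m \<Rightarrow> real) \<Rightarrow> (real \<Rightarrow> real) \<Rightarrow>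
     (nat \<Rightarrow> real) \<Rightarrow> (nat \<Rightarrow> real) \<Rightarrow> (nat \<Rightarrow> 'n \<times> 'n \<Rightarrow> 'p \<Rightarrow> real^'m) \<Rightarrow> real^'m^'n \<Rightarrow>
     nat \<Rightarrow> 'p \<Rightarrow> real^'m^'n" where
  "iterate E f \<Psi> \<alpha> \<beta> \<xi> x0 0 = (\<lambda>\<omega>. x0)"
| "iterate E f \<Psi> \<alpha> \<beta> \<xi> x0 (Suc t) = (\<lambda>\<omega>.
     let x = iterate E f \<Psi> \<alpha> \<beta> \<xi> x0 t \<omega>
     in \<chi> i. x $ i
          - \<beta> t *\<^sub>R (\<Sum>j\<in>neighbors E i. componentwise \<Psi> (x $ i - x $ j + \<xi> t (i, j) \<omega>))
          - \<alpha> t *\<^sub>R grad (f i) (x $ i))"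

end

theory Submission
  imports Defs "HOL-Real_Asymp.Real_Asymp"
begin

text \<open>The mean-squared error actually tends to \<open>0\<close>, so the bounds hold with room to spare. For every
  \<open>\<epsilon> > 0\<close> one has \<open>\<bar>u\<bar> \<le> \<epsilon> + u \<phi>(u) / \<phi>(\<epsilon>)\<close>, so the disagreement of the agents is at most a multiple of
  \<open>\<epsilon>\<close> plus a multiple of the dissipation \<open>\<Sum> u \<phi>(u)\<close> over the arcs. The gradients at the minimizer sum to \<open>0\<close>,
  hence they perturb the squared error only through \<open>\<alpha>\<^sub>t\<close> times the disagreement, and as \<open>\<alpha>\<^sub>t / \<beta>\<^sub>t \<rightarrow> 0\<close>
  this is eventually absorbed by the dissipation, which enters with the factor \<open>- \<beta>\<^sub>t\<close>. What remains is
  \<open>m\<^sub>t\<^sub>+\<^sub>1 \<le> (1 - \<mu> \<alpha>\<^sub>t) m\<^sub>t + C \<epsilon> \<alpha>\<^sub>t + O(\<beta>\<^sub>t\<^sup>2)\<close>, and \<open>\<beta>\<^sub>t\<^sup>2 / \<alpha>\<^sub>t \<rightarrow> 0\<close> because \<open>\<delta> > 1/2\<close>.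
  The asymptotic bound of the theorem is positive, and its rate therefore immaterial, unless \<open>M N = 1\<close>
  or the constant \<open>c~\<close> is \<open>0\<close>; for \<open>M N = 1\<close> the algorithm is noiseless gradient descent, whose
  rate is computed directly.\<close>

section \<open>The smoothed nonlinearity\<close>

lemma density_integrable:
  assumes "symmetric_noise_density p"
  shows "integrable lborel p" "(LINT w|lborel. p w) = 1"
proof -
  have m: "p \<in> borel_measurable lborel" and nn: "\<And>u. 0 \<le> p u"
    and one: "(\<integral>\<^sup>+ u. ennreal (p u) \<partial>lborel) = ennreal 1"
    using assms by (auto simp: symmetric_noise_density_def)
  then show i: "integrable lborel p"
    by (intro integrableI_nonneg) auto
  show "(LINT w|lborel. p w) = 1"
    using one nn i by (simp add: nn_integral_eq_integral)
qed

section \<open>The nonlinearity \<Psi> and its average \<phi> over the noise\<close>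

locale robust_nonlinearity =
  fixes p \<Psi> :: "real \<Rightarrow> real"
  assumes density: "symmetric_noise_density p"
    and admissible: "admissible_nonlinearity \<Psi>"
begin

abbreviation "\<phi> \<equiv> phi \<Psi> p"

lemma
  shows p_measurable [measurable]: "p \<in> borel_measurable borel"
    and p_nonneg: "0 \<le> p u"
    and p_sym: "p (- u) = p u"
    and \<Psi>_odd: "\<Psi> (- u) = - \<Psi> u"
    and \<Psi>_mono: "mono \<Psi>"
    and \<Psi>_cont: "continuous_on S \<Psi>"
    and \<Psi>_deriv: "(\<Psi> has_real_derivative deriv \<Psi> u) (at u)"
  using density admissible continuous_on_subset[of UNIV \<Psi> S]
  by (auto simp: symmetric_noise_density_def admissible_nonlinearity_def DERIV_deriv_iff_real_differentiable)

lemma \<Psi>_measurable [measurable]: "\<Psi> \<in> borel_measurable borel"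
  using \<Psi>_cont by (rule borel_measurable_continuous_onI)

lemma \<Psi>_bounded: obtains c where "0 < c" "\<And>u. \<bar>\<Psi> u\<bar> \<le> c"
  using admissible by (auto simp: admissible_nonlinearity_def)

lemma \<Psi>_lipschitz: obtains c where "0 < c" "\<And>u v. \<bar>\<Psi> u - \<Psi> v\<bar> \<le> c * \<bar>u - v\<bar>"
proof -
  obtain c where c: "0 < c" "\<And>u. \<bar>deriv \<Psi> u\<bar> \<le> c"
    using admissible by (auto simp: admissible_nonlinearity_def)
  have "\<bar>\<Psi> u - \<Psi> v\<bar> \<le> c * \<bar>u - v\<bar>" for u v
    using field_differentiable_bound[of UNIV \<Psi> "deriv \<Psi>" c u v] \<Psi>_deriv c by auto
  with c show ?thesis using that by blast
qed

lemma phi_integrable: "integrable lborel (\<lambda>w. \<Psi> (u + w) * p w)"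
proof -
  obtain c where c: "0 < c" "\<And>u. \<bar>\<Psi> u\<bar> \<le> c"
    using \<Psi>_bounded by blast
  show ?thesis
  proof (rule Bochner_Integration.integrable_bound)
    show "integrable lborel (\<lambda>w. c * p w)"
      using density_integrable[OF density] by simp
    show "AE w in lborel. norm (\<Psi> (u + w) * p w) \<le> norm (c * p w)"
      using c p_nonneg by (auto simp: abs_mult intro!: mult_right_mono)
  qed simp
qed

text \<open>As \<open>p\<close> has total mass 1, averaging preserves every bound of \<Psi>; the
  theorem takes such a bound as its \<open>c1'\<close>.\<close>

lemma phi_bounded:
  assumes "\<And>u. \<bar>\<Psi> u\<bar> \<le> c"
  shows "\<bar>\<phi> u\<bar> \<le> c"
proof -
  have "\<bar>\<phi> u\<bar> \<le> (LINT w|lborel. \<bar>\<Psi> (u + w) * p w\<bar>)"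
    unfolding phi_def by (rule integral_abs_bound)
  also have "\<dots> \<le> (LINT w|lborel. c * p w)"
    using integrable_abs[OF phi_integrable] density_integrable[OF density] assms p_nonneg
    by (intro integral_mono) (auto simp: abs_mult intro!: mult_right_mono)
  finally show ?thesis using density_integrable[OF density] by simp
qed

lemma phi_mono: "mono \<phi>"
  unfolding phi_def
  by (intro monoI integral_mono phi_integrable mult_right_mono p_nonneg monoD[OF \<Psi>_mono]) simp

text \<open>Reflecting the integration variable combines the symmetry of \<open>p\<close> with the
  oddness of \<Psi>.\<close>

lemma phi_odd: "\<phi> (- u) = - \<phi> u"
proof -
  have "\<phi> (- u) = (LINT w|lborel. \<Psi> (- u - w) * p (- w))"
    unfolding phi_def
    using lborel_integral_real_affine[of "-1" "\<lambda>w. \<Psi> (- u + w) * p w" 0] by simp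
  also have "\<dots> = (LINT w|lborel. - (\<Psi> (u + w) * p w))"
    by (intro Bochner_Integration.integral_cong) (use \<Psi>_odd[of "u + w" for w] in \<open>auto simp: p_sym\<close>)
  finally show ?thesis by (simp add: phi_def)
qed

lemma phi_0: "\<phi> 0 = 0"
  using phi_odd[of 0] by simp

lemma phi_measurable [measurable]: "\<phi> \<in> borel_measurable borel"
  using phi_mono by (rule borel_measurable_mono)

section \<open>The derivative of \<phi> at 0 and lower bounds for \<phi>\<close>

lemma \<Psi>_deriv_nonneg: "0 \<le> deriv \<Psi> u"
  using mono_on_imp_deriv_nonneg[OF _ \<Psi>_deriv, of UNIV] \<Psi>_mono by (simp add: mono_on_def mono_def)

text \<open>The derivative exists everywhere but may be discontinuous; it is the pointwise limit of
  the difference quotients with increments 1/(n+1).\<close>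

lemma deriv_\<Psi>_measurable [measurable]: "deriv \<Psi> \<in> borel_measurable borel"
proof (rule borel_measurable_LIMSEQ_real)
  fix u
  have "((\<lambda>h. (\<Psi> (u + h) - \<Psi> u) / h) \<longlongrightarrow> deriv \<Psi> u) (at 0)"
    using \<Psi>_deriv by (simp add: DERIV_def)
  moreover have "filterlim (\<lambda>n. inverse (real (Suc n))) (at 0) sequentially"
    by (intro filterlim_atI LIMSEQ_inverse_real_of_nat) auto
  ultimately show "(\<lambda>n. (\<Psi> (u + inverse (real (Suc n))) - \<Psi> u) / inverse (real (Suc n))) \<longlonglongrightarrow> deriv \<Psi> u"
    by (rule filterlim_compose)
qed measurable

text \<open>Differentiation under the integral sign by dominated convergence along sequences: a
  Lipschitz constant of \<Psi> times \<open>p\<close> dominates all difference quotients. The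
  integral formula is what makes the sign of the derivative accessible.\<close>

lemma phi_has_derivative: "(\<phi> has_real_derivative (LINT w|lborel. deriv \<Psi> w * p w)) (at 0)"
  unfolding DERIV_def tendsto_at_iff_sequentially
proof (intro allI impI)
  fix h :: "nat \<Rightarrow> real"
  assume h: "\<forall>n. h n \<in> UNIV - {0}" "h \<longlonglongrightarrow> 0"
  obtain c where c: "0 < c" "\<And>u v. \<bar>\<Psi> u - \<Psi> v\<bar> \<le> c * \<bar>u - v\<bar>"
    using \<Psi>_lipschitz by blast
  have "(\<lambda>n. LINT w|lborel. (\<Psi> (h n + w) - \<Psi> w) / h n * p w) \<longlonglongrightarrow> (LINT w|lborel. deriv \<Psi> w * p w)"
  proof (rule integral_dominated_convergence)
    show "integrable lborel (\<lambda>w. c * p w)"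
      using density_integrable[OF density] by simp
    have "filterlim h (at 0) sequentially"
      using h by (intro filterlim_atI) auto
    from filterlim_compose[OF _ this] have "(\<lambda>n. (\<Psi> (w + h n) - \<Psi> w) / h n) \<longlonglongrightarrow> deriv \<Psi> w" for w
      using \<Psi>_deriv[of w] by (simp add: DERIV_def)
    then show "AE w in lborel. (\<lambda>n. (\<Psi> (h n + w) - \<Psi> w) / h n * p w) \<longlonglongrightarrow> deriv \<Psi> w * p w"
      by (intro AE_I2 tendsto_mult_right) (simp add: add.commute)
    show "AE w in lborel. norm ((\<Psi> (h n + w) - \<Psi> w) / h n * p w) \<le> c * p w" for n
    proof (intro AE_I2)
      fix w
      have "\<bar>(\<Psi> (h n + w) - \<Psi> w) / h n\<bar> \<le> c"
        using c(2)[of "h n + w" w] h by (simp add: pos_divide_le_eq)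
      then show "norm ((\<Psi> (h n + w) - \<Psi> w) / h n * p w) \<le> c * p w"
        using mult_right_mono[OF _ p_nonneg[of w]] p_nonneg[of w]
        by (metis abs_mult abs_of_nonneg real_norm_def)
    qed
  qed simp_all
  moreover have "(\<lambda>n. LINT w|lborel. (\<Psi> (h n + w) - \<Psi> w) / h n * p w) = (\<lambda>n. (\<phi> (0 + h n) - \<phi> 0) / h n)"
  proof
    fix n
    have "(LINT w|lborel. (\<Psi> (h n + w) - \<Psi> w) / h n * p w)
        = (LINT w|lborel. (\<Psi> (h n + w) * p w - \<Psi> (0 + w) * p w) / h n)"
      by (intro Bochner_Integration.integral_cong) (auto simp: algebra_simps diff_divide_distrib)
    then show "(LINT w|lborel. (\<Psi> (h n + w) - \<Psi> w) / h n * p w) = (\<phi> (0 + h n) - \<phi> 0) / h n"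
      by (simp add: phi_def phi_integrable phi_integrable[of 0, simplified])
  qed
  ultimately show "((\<lambda>h. (\<phi> (0 + h) - \<phi> 0) / h) \<circ> h) \<longlonglongrightarrow> (LINT w|lborel. deriv \<Psi> w * p w)"
    unfolding comp_def by (simp only:)
qed

lemma deriv_phi_0: "deriv \<phi> 0 = (LINT w|lborel. deriv \<Psi> w * p w)"
  using phi_has_derivative by (rule DERIV_imp_deriv)

text \<open>Otherwise \<open>\<Psi>'\<close> would vanish almost everywhere on a neighbourhood of \<open>0\<close>, so that \<open>\<Psi>\<close> would be
  constant there.\<close>

lemma phi_deriv_pos: "0 < deriv \<phi> 0"
proof (rule ccontr)
  assume "\<not> 0 < deriv \<phi> 0"
  obtain c where c: "0 < c" "\<And>u. \<bar>deriv \<Psi> u\<bar> \<le> c"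
    using admissible by (auto simp: admissible_nonlinearity_def)
  have int: "integrable lborel (\<lambda>w. deriv \<Psi> w * p w)"
  proof (rule Bochner_Integration.integrable_bound)
    show "integrable lborel (\<lambda>w. c * p w)"
      using density_integrable[OF density] by simp
    show "AE w in lborel. norm (deriv \<Psi> w * p w) \<le> norm (c * p w)"
      using c p_nonneg by (auto simp: abs_mult intro!: mult_right_mono)
  qed simp
  have nonneg: "0 \<le> deriv \<Psi> w * p w" for w
    using \<Psi>_deriv_nonneg p_nonneg by simp
  have "(LINT w|lborel. deriv \<Psi> w * p w) = 0"
    using \<open>\<not> 0 < deriv \<phi> 0\<close> nonneg by (simp add: deriv_phi_0 not_less antisym)
  then have "AE w in lborel. deriv \<Psi> w * p w = 0"
    using integral_nonneg_eq_0_iff_AE[OF int] nonneg by auto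
  \<comment> \<open>The gauge integral used next ignores \<open>negligible\<close> sets, which are
    the null sets of the completed measure.\<close>
  then have "AE w in lebesgue. deriv \<Psi> w * p w = 0"
    by (rule AE_completion)
  then have negl: "negligible {w. deriv \<Psi> w * p w \<noteq> 0}"
    by (simp add: AE_iff_null_sets negligible_iff_null_sets eventually_ae_filter) 
  obtain r where r: "0 < r" "\<And>u. \<bar>u\<bar> \<le> r \<Longrightarrow> 0 < p u"
    using density by (auto simp: symmetric_noise_density_def)
  have "(deriv \<Psi> has_integral 0) {0..r}"
  proof (rule has_integral_spike[OF negl _ has_integral_0])
    fix w assume w: "w \<in> {0..r} - {w. deriv \<Psi> w * p w \<noteq> 0}"
    then have "0 < p w" using r by simp
    with w show "deriv \<Psi> w = 0" by simp
  qed
  \<comment> \<open>The gauge integral obeys the fundamental theorem for every derivative that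
    exists everywhere, so the same integral also equals the increment of \<Psi>.\<close>
  moreover have "(deriv \<Psi> has_integral (\<Psi> r - \<Psi> 0)) {0..r}"
  proof (rule fundamental_theorem_of_calculus)
    show "(\<Psi> has_vector_derivative deriv \<Psi> w) (at w within {0..r})" for w
      using has_field_derivative_at_within[OF \<Psi>_deriv]
      by (simp only: has_real_derivative_iff_has_vector_derivative)
  qed (use r in simp)
  ultimately have "\<Psi> r = \<Psi> 0"
    using has_integral_unique[of "deriv \<Psi>" 0 "{0..r}" "\<Psi> r - \<Psi> 0"] by simp
  moreover have "0 < \<Psi> r" "\<Psi> 0 = 0"
    using admissible r \<Psi>_odd[of 0] by (auto simp: admissible_nonlinearity_def)
  ultimately show False by simp
qed

text \<open>Near 0 the quotient \<phi>(u)/u stays above half its limit, and \<open>G\<close> lies in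
  that range. Beyond \<open>G\<close> monotonicity suffices: for u < g the left side is at most its
  value at u = g, which is below \<phi>(G).\<close>

lemma phi_linear_bound:
  obtains G where "0 < G" "\<And>g u. G \<le> g \<Longrightarrow> \<bar>u\<bar> < g \<Longrightarrow> deriv \<phi> 0 * G * \<bar>u\<bar> / (2 * g) \<le> \<bar>\<phi> u\<bar>"
proof -
  let ?D = "deriv \<phi> 0"
  have "((\<lambda>h. \<phi> h / h) \<longlongrightarrow> ?D) (at 0)"
    using phi_has_derivative by (simp add: DERIV_def phi_0 deriv_phi_0)
  then have "\<forall>\<^sub>F h in at 0. ?D / 2 < \<phi> h / h"
    using phi_deriv_pos by (intro order_tendstoD(1)) auto
  then obtain d where d: "0 < d" "\<And>h. h \<noteq> 0 \<Longrightarrow> \<bar>h\<bar> < d \<Longrightarrow> ?D / 2 < \<phi> h / h"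
    by (auto simp: eventually_at dist_real_def)
  \<comment> \<open>Halving \<open>d\<close> keeps the point \<open>G\<close> itself strictly inside
    the range where the quotient is controlled.\<close>
  define G where "G = d / 2"
  have small: "?D * u / 2 \<le> \<phi> u" if "0 \<le> u" "u \<le> G" for u
    using d(2)[of u] that d(1) phi_0 by (cases "u = 0") (auto simp: G_def field_simps)
  have main: "?D * G * u / (2 * g) \<le> \<phi> u" if "G \<le> g" "0 \<le> u" "u < g" for g u
  proof (cases "u \<le> G")
    case True
    have "?D * u * G \<le> ?D * u * g"
      using that phi_deriv_pos by (intro mult_left_mono) auto
    then have "?D * G * u / (2 * g) \<le> ?D * u / 2"
      using that by (simp add: field_simps)
    also have "\<dots> \<le> \<phi> u"
      using small True that by blast
    finally show ?thesis .
  next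
    case False
    have "?D * G * u \<le> ?D * G * g"
      using that phi_deriv_pos d by (intro mult_left_mono) (auto simp: G_def)
    then have "?D * G * u / (2 * g) \<le> ?D * G / 2"
      using that by (auto simp: field_simps)
    also have "\<dots> \<le> \<phi> G"
      using small[of G] d by (simp add: G_def)
    also have "\<dots> \<le> \<phi> u"
      using False by (intro monoD[OF phi_mono]) simp
    finally show ?thesis .
  qed
  have "\<phi> \<bar>u\<bar> \<le> \<bar>\<phi> u\<bar>" for u
    using phi_odd[of u] by (cases "0 \<le> u") auto
  with main[of _ "\<bar>u\<bar>" for u] have "?D * G * \<bar>u\<bar> / (2 * g) \<le> \<bar>\<phi> u\<bar>" if "G \<le> g" "\<bar>u\<bar> < g" for g u
    using that by (meson abs_ge_zero order_trans)
  then show ?thesis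
    using that[of G] d by (simp add: G_def)
qed

lemma phi_pos:
  assumes "0 < u"
  shows "0 < \<phi> u"
proof -
  obtain G where G: "0 < G" "\<And>g u. G \<le> g \<Longrightarrow> \<bar>u\<bar> < g \<Longrightarrow> deriv \<phi> 0 * G * \<bar>u\<bar> / (2 * g) \<le> \<bar>\<phi> u\<bar>"
    using phi_linear_bound by blast
  \<comment> \<open>The choice \<open>g = G + u + 1\<close> exceeds both \<open>G\<close> and
    \<open>u\<close>, so the linear bound rules out a zero at \<open>u\<close>.\<close>
  have "0 < deriv \<phi> 0 * G * u / (2 * (G + u + 1))"
    using assms G phi_deriv_pos by simp
  with G(2)[of "G + u + 1" u] assms G(1) have "\<phi> u \<noteq> 0"
    by auto
  moreover have "0 \<le> \<phi> u"
    using monoD[OF phi_mono, of 0 u] assms phi_0 by simp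
  ultimately show ?thesis by simp
qed

lemma mult_phi_nonneg: "0 \<le> u * \<phi> u"
  using phi_pos[of u] phi_pos[of "- u"] phi_odd[of u]
  by (cases u "0::real" rule: linorder_cases) (auto simp: mult_nonpos_nonpos)

text \<open>Beyond \<epsilon> monotonicity gives \<phi>(\<bar>u\<bar>) \<ge> \<phi>(\<epsilon>).
  Since \<phi> is bounded, u \<phi>(u) grows only linearly, so it can dominate \<bar>u\<bar> but not
  its square.\<close>

lemma abs_le_phi:
  assumes "0 < \<epsilon>"
  shows "\<bar>u\<bar> \<le> \<epsilon> + u * \<phi> u / \<phi> \<epsilon>"
proof (cases "\<bar>u\<bar> \<le> \<epsilon>")
  case True
  then show ?thesis
    using mult_phi_nonneg[of u] phi_pos[OF assms] by (simp add: add_increasing2)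
next
  case False
  have *: "u * \<phi> u = \<bar>u\<bar> * \<phi> \<bar>u\<bar>"
    using phi_odd[of u] by (cases "0 \<le> u") auto
  have "\<bar>u\<bar> * \<phi> \<epsilon> \<le> \<bar>u\<bar> * \<phi> \<bar>u\<bar>"
    using False monoD[OF phi_mono, of \<epsilon> "\<bar>u\<bar>"] by (intro mult_left_mono) auto
  then have "\<bar>u\<bar> \<le> u * \<phi> u / \<phi> \<epsilon>"
    using phi_pos[OF assms] * by (simp add: field_simps)
  with assms show ?thesis by simp
qed

end

section \<open>Gradients, graphs and recursions\<close>

lemma differentiable_imp_GDERIV:
  fixes f :: "'a::euclidean_space \<Rightarrow> real"
  assumes "f differentiable (at x)"
  shows "GDERIV f x :> grad f x"
proof -
  obtain f' where f': "(f has_derivative f') (at x)"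
    using assms by (auto simp: differentiable_def)
  interpret bounded_linear f' using f' by (rule has_derivative_bounded_linear)
  \<comment> \<open>Riesz representation: the adjoint of the derivative, applied to 1, is the
    gradient.\<close>
  have "f' h = inner h (adjoint f' 1)" for h
    using adjoint_works[OF linear_axioms, of h 1] by simp
  then have "GDERIV f x :> adjoint f' 1"
    using f' unfolding gderiv_def by (metis (no_types, lifting) ext)
  then show ?thesis by (simp add: grad_eqI)
qed

locale convex_cost =
  fixes f :: "real^'m::finite \<Rightarrow> real" and \<mu> L :: real
  assumes \<mu>_pos: "0 < \<mu>"
    and smooth: "twice_cont_differentiable f"
    and hessian_ge: "\<And>x. loewner_le (\<mu> *\<^sub>R mat 1) (hessian f x)"
    and hessian_le: "\<And>x. loewner_le (hessian f x) (L *\<^sub>R mat 1)"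
begin

lemma has_grad: "GDERIV f x :> grad f x"
  using smooth by (intro differentiable_imp_GDERIV) (simp add: twice_cont_differentiable_def)

lemma grad_has_derivative: "(grad f has_derivative (\<lambda>h. hessian f x *v h)) (at x)"
  using smooth jacobian_works[of "grad f" "at x"] by (simp add: twice_cont_differentiable_def hessian_def)

lemma grad_continuous: "continuous_on S (grad f)"
  by (rule has_derivative_continuous_on[OF has_derivative_at_withinI[OF grad_has_derivative]])

lemma hessian_bounds: "\<mu> * (v \<bullet> v) \<le> v \<bullet> (hessian f x *v v)" "v \<bullet> (hessian f x *v v) \<le> L * (v \<bullet> v)"
  using hessian_ge[of x] hessian_le[of x]
  by (auto simp: loewner_le_def pos_semidef_def matrix_vector_mult_diff_rdistrib inner_diff_right
      scaleR_matrix_vector_assoc[symmetric])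

text \<open>The order \<open>loewner_le\<close> includes symmetry of the difference, so
  \<open>L *\<^sub>R mat 1\<close> minus the Hessian is symmetric, and with it the Hessian.\<close>

lemma hessian_symmetric: "v \<bullet> (hessian f x *v w) = w \<bullet> (hessian f x *v v)"
proof -
  have "transpose (L *\<^sub>R mat 1 - hessian f x) = L *\<^sub>R mat 1 - hessian f x"
    using hessian_le[of x] by (simp add: loewner_le_def pos_semidef_def)
  then have sym: "(L *\<^sub>R mat 1 - hessian f x) $ j $ i = (L *\<^sub>R mat 1 - hessian f x) $ i $ j" for i j
    by (simp add: transpose_def vec_eq_iff)
  have "hessian f x $ j $ i = hessian f x $ i $ j" for i j
    using sym[of i j] by (cases "i = j") (simp_all add: mat_def)
  then have "transpose (hessian f x) = hessian f x"
    by (simp add: transpose_def vec_eq_iff)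
  then show ?thesis
    using dot_lmul_matrix[of v "hessian f x" w] transpose_matrix_vector[of "hessian f x" v]
    by (simp add: inner_commute)
qed

lemma L_pos: "0 < L"
proof -
  obtain b :: "real^'m" where "b \<in> Basis" by (meson SOME_Basis)
  then have "b \<bullet> b = 1" by (simp add: inner_Basis)
  then show ?thesis using hessian_bounds[of b 0] \<mu>_pos by simp
qed

text \<open>Polarization writes the bilinear form as a difference of two values of the quadratic
  form; the subtracted one is nonnegative. For vectors of equal norm r the right side is L r^2,
  which is how the Lipschitz constant arises.\<close>

lemma hessian_bilinear_le: "v \<bullet> (hessian f x *v w) \<le> L / 4 * (norm v + norm w)\<^sup>2"
proof -
  let ?H = "hessian f x"
  have "4 * (v \<bullet> (?H *v w)) = (v + w) \<bullet> (?H *v (v + w)) - (v - w) \<bullet> (?H *v (v - w))"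
    using hessian_symmetric[of v x w]
    by (simp add: matrix_vector_right_distrib matrix_vector_mult_diff_distrib inner_simps)
  also have "\<dots> \<le> L * (norm (v + w))\<^sup>2"
    using hessian_bounds(2)[of "v + w" x] hessian_bounds(1)[of "v - w" x] \<mu>_pos
    by (smt (verit) inner_ge_zero mult_nonneg_nonneg power2_norm_eq_inner)
  also have "\<dots> \<le> L * (norm v + norm w)\<^sup>2"
    using L_pos by (intro mult_left_mono power_mono norm_triangle_ineq) auto
  finally show ?thesis by simp
qed

text \<open>The mean value theorem has no equality form for vector-valued maps, so it is applied to
  the gradient along the segment, tested against a fixed \<open>w\<close>. The point
  \<open>z\<close> depends on \<open>w\<close>.\<close>

lemma grad_mvt:
  obtains z where "w \<bullet> (grad f x - grad f y) = w \<bullet> (hessian f z *v (x - y))"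
proof -
  let ?g = "\<lambda>s. w \<bullet> grad f (y + s *\<^sub>R (x - y))"
  have "(?g has_real_derivative w \<bullet> (hessian f (y + s *\<^sub>R (x - y)) *v (x - y))) (at s)" for s
  proof -
    have "((\<lambda>s. y + s *\<^sub>R (x - y)) has_derivative (\<lambda>h. h *\<^sub>R (x - y))) (at s)"
      by (auto intro!: derivative_eq_intros)
    from has_derivative_compose[OF this grad_has_derivative]
    have "(?g has_derivative (\<lambda>h. w \<bullet> (hessian f (y + s *\<^sub>R (x - y)) *v (h *\<^sub>R (x - y))))) (at s)"
      by (rule has_derivative_inner_right)
    moreover have "(\<lambda>h. w \<bullet> (hessian f (y + s *\<^sub>R (x - y)) *v (h *\<^sub>R (x - y))))
        = (*) (w \<bullet> (hessian f (y + s *\<^sub>R (x - y)) *v (x - y)))"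
      by (rule ext) (simp only: matrix_vector_mult_scaleR inner_scaleR_right mult.commute)
    ultimately show ?thesis
      by (simp only: has_field_derivative_def)
  qed
  then obtain s where "?g 1 - ?g 0 = (1 - 0) * (w \<bullet> (hessian f (y + s *\<^sub>R (x - y)) *v (x - y)))"
    using MVT2[of 0 1 ?g "\<lambda>s. w \<bullet> (hessian f (y + s *\<^sub>R (x - y)) *v (x - y))"] by auto
  then show ?thesis
    using that[of "y + s *\<^sub>R (x - y)"] by (simp add: inner_diff_right)
qed

lemma grad_strongly_monotone: "\<mu> * (norm (x - y))\<^sup>2 \<le> (x - y) \<bullet> (grad f x - grad f y)"
proof -
  obtain z where "(x - y) \<bullet> (grad f x - grad f y) = (x - y) \<bullet> (hessian f z *v (x - y))"
    by (rule grad_mvt)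
  with hessian_bounds(1)[of "x - y" z] show ?thesis
    by (simp add: power2_norm_eq_inner)
qed

lemma grad_lipschitz: "norm (grad f x - grad f y) \<le> L * norm (x - y)"
proof -
  define d where "d = grad f x - grad f y"
  \<comment> \<open>The test vector points along the gradient difference but has the length of
    \<open>x - y\<close>, so that the bilinear bound loses nothing.\<close>
  define w where "w = (norm (x - y) / norm d) *\<^sub>R d"
  show ?thesis
  proof (cases "d = 0 \<or> x = y")
    case True
    with L_pos show ?thesis by (auto simp: d_def)
  next
    case False
    then have nw: "norm w = norm (x - y)"
      by (simp add: w_def)
    have "norm (x - y) * norm d = w \<bullet> d"
      using False by (simp add: w_def power2_norm_eq_inner[symmetric] power2_eq_square)
    also obtain z where "w \<bullet> d = w \<bullet> (hessian f z *v (x - y))"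
      unfolding d_def by (rule grad_mvt)
    also have "\<dots> \<le> L / 4 * (norm (x - y) + norm (x - y))\<^sup>2"
      using hessian_bilinear_le[of w z "x - y"] nw by simp
    finally show ?thesis
      using False by (simp add: d_def power2_eq_square)
  qed
qed

end

text \<open>Each arc of a path from \<open>i\<close> to \<open>j\<close> costs at most the whole
  sum, so the length of the path serves as a factor. It is chosen before \<open>y\<close>, and
  summing the factors over all pairs gives a constant that serves every pair.\<close>

lemma connected_graph_difference_bound:
  fixes E :: "'n::finite set set"
  assumes "connected_graph E"
  obtains C where "0 \<le> C"
    "\<And>(y :: 'n \<Rightarrow> 'v::real_normed_vector) i j. norm (y i - y j) \<le> C * (\<Sum>(k, l)\<in>arcs E. norm (y k - y l))"
proof -
  let ?S = "\<lambda>y :: 'n \<Rightarrow> 'v. \<Sum>(k, l)\<in>arcs E. norm (y k - y l)"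
  have nn: "0 \<le> ?S y" for y by (intro sum_nonneg) auto
  have "\<exists>n::nat. \<forall>y. norm (y i - y j) \<le> real n * ?S y" for i j
  proof -
    have "(i, j) \<in> (arcs E)\<^sup>*" using assms by (simp add: connected_graph_def)
    then show ?thesis
    proof (induction rule: rtrancl_induct)
      case base
      show ?case by (intro exI[of _ 0]) simp
    next
      case (step j k)
      then obtain n :: nat where n: "\<And>y. norm (y i - y j) \<le> real n * ?S y" by blast
      have "norm (y i - y k) \<le> real (Suc n) * ?S y" for y
      proof -
        have "norm (y j - y k) \<le> ?S y"
          using member_le_sum[of "(j, k)" "arcs E" "\<lambda>(k, l). norm (y k - y l)"] step(2) by auto
        moreover have "norm (y i - y k) \<le> norm (y i - y j) + norm (y j - y k)"
          using norm_triangle_ineq[of "y i - y j" "y j - y k"] by simp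
        ultimately show ?thesis using n[of y] by (simp add: algebra_simps)
      qed
      then show ?case by blast
    qed
  qed
  then obtain n :: "'n \<Rightarrow> 'n \<Rightarrow> nat" where n: "\<And>i j y. norm (y i - y j) \<le> real (n i j) * ?S y" by metis
  have "norm (y i - y j) \<le> real (\<Sum>i\<in>UNIV. \<Sum>j\<in>UNIV. n i j) * ?S y" for y i j
  proof -
    have "n i j \<le> (\<Sum>j\<in>UNIV. n i j)" by (rule member_le_sum) auto
    also have "\<dots> \<le> (\<Sum>i\<in>UNIV. \<Sum>j\<in>UNIV. n i j)"
      by (rule member_le_sum[of i UNIV "\<lambda>i. \<Sum>j\<in>UNIV. n i j"]) auto
    finally show ?thesis
      using n[of y i j] nn[of y] by (meson mult_right_mono of_nat_mono order_trans)
  qed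
  then show ?thesis using that of_nat_0_le_iff by blast
qed

text \<open>Above any positive level the recursion eventually contracts by the factors 1 - \<alpha>
  \<mu> \<le> exp(- \<mu> \<alpha>), and their product tends to 0 because the step sizes have a
  divergent sum.\<close>

lemma stochastic_recursion_tendsto_0:
  fixes m \<alpha> :: "nat \<Rightarrow> real"
  assumes "\<And>t. 0 \<le> m t" "0 < \<mu>" "\<And>t. 0 \<le> \<alpha> t" "\<alpha> \<longlonglongrightarrow> 0" "\<not> summable \<alpha>"
    and rec: "\<And>\<epsilon>. 0 < \<epsilon> \<Longrightarrow> \<forall>\<^sub>F t in sequentially. m (Suc t) \<le> (1 - \<alpha> t * \<mu>) * m t + \<alpha> t * \<epsilon>"
  shows "m \<longlonglongrightarrow> 0"
proof (rule LIMSEQ_I)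
  fix r :: real assume "0 < r"
  \<comment> \<open>This value makes r/2 the fixed point of the affine recursion, for every step
    size.\<close>
  define \<epsilon> where "\<epsilon> = r * \<mu> / 2"
  have "0 < \<epsilon>" using \<open>0 < r\<close> \<open>0 < \<mu>\<close> by (simp add: \<epsilon>_def)
  \<comment> \<open>This keeps the contraction factor nonnegative, so that upper bounds may be
    multiplied by it.\<close>
  have "\<forall>\<^sub>F t in sequentially. \<alpha> t < 1 / \<mu>"
    using assms by (intro order_tendstoD(2)) auto
  with rec[OF \<open>0 < \<epsilon>\<close>] have "\<forall>\<^sub>F t in sequentially. \<alpha> t < 1 / \<mu> \<and> m (Suc t) \<le> (1 - \<alpha> t * \<mu>) * m t + \<alpha> t * \<epsilon>"
    by eventually_elim auto
  then obtain T where T: "\<And>t. T \<le> t \<Longrightarrow> \<alpha> t < 1 / \<mu>"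
      "\<And>t. T \<le> t \<Longrightarrow> m (Suc t) \<le> (1 - \<alpha> t * \<mu>) * m t + \<alpha> t * \<epsilon>"
    by (auto simp: eventually_sequentially)
  have step: "m (Suc t) - r / 2 \<le> (1 - \<alpha> t * \<mu>) * (m t - r / 2)" if "T \<le> t" for t
    using T(2)[OF that] by (simp add: \<epsilon>_def algebra_simps)
  \<comment> \<open>The right side carries \<open>m T\<close>, not \<open>m T - r / 2\<close>: it
    must be nonnegative for the factor to be enlarged to an exponential.\<close>
  have bound: "m (T + n) - r / 2 \<le> exp (- \<mu> * (\<Sum>k<n. \<alpha> (T + k))) * m T" for n
  proof (induction n)
    case 0
    then show ?case using \<open>0 < r\<close> by simp
  next
    case (Suc n)
    let ?q = "1 - \<alpha> (T + n) * \<mu>"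
    have q: "0 \<le> ?q" "?q \<le> exp (- \<mu> * \<alpha> (T + n))"
      using T(1)[of "T + n"] \<open>0 < \<mu>\<close> exp_ge_add_one_self[of "- \<mu> * \<alpha> (T + n)"]
      by (auto simp: field_simps)
    have "m (T + Suc n) - r / 2 \<le> ?q * (m (T + n) - r / 2)"
      using step[of "T + n"] by simp
    also have "\<dots> \<le> ?q * (exp (- \<mu> * (\<Sum>k<n. \<alpha> (T + k))) * m T)"
      using Suc q by (intro mult_left_mono)
    also have "\<dots> \<le> exp (- \<mu> * \<alpha> (T + n)) * (exp (- \<mu> * (\<Sum>k<n. \<alpha> (T + k))) * m T)"
      using q assms by (intro mult_right_mono) auto
    also have "\<dots> = exp (- \<mu> * (\<Sum>k<Suc n. \<alpha> (T + k))) * m T"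
      by (simp add: exp_add[symmetric] algebra_simps)
    finally show ?case .
  qed
  have "filterlim (\<lambda>n. \<Sum>k<n. \<alpha> (T + k)) at_top sequentially"
    unfolding filterlim_at_top_dense
  proof
    fix B
    have "\<not> summable (\<lambda>k. \<alpha> (T + k))"
      using assms summable_iff_shift[of \<alpha> T] by (simp add: add.commute)
    then obtain N where N: "B < (\<Sum>k<N. \<alpha> (T + k))"
      using assms(3) by (meson not_le summableI_nonneg_bounded)
    have "B < (\<Sum>k<n. \<alpha> (T + k))" if "N \<le> n" for n
      using assms(3) that by (intro less_le_trans[OF N] sum_mono2) auto
    then show "\<forall>\<^sub>F n in sequentially. B < (\<Sum>k<n. \<alpha> (T + k))"
      by (auto simp: eventually_sequentially)
  qed
  then have "(\<lambda>n. exp (- \<mu> * (\<Sum>k<n. \<alpha> (T + k))) * m T) \<longlonglongrightarrow> 0"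
    using assms
    by (intro tendsto_mult_left_zero filterlim_compose[OF exp_at_bot] filterlim_tendsto_neg_mult_at_bot[OF tendsto_const])
      auto
  then have "\<forall>\<^sub>F n in sequentially. exp (- \<mu> * (\<Sum>k<n. \<alpha> (T + k))) * m T < r / 2"
    using \<open>0 < r\<close> by (intro order_tendstoD(2)) auto
  then obtain N where N: "\<And>n. N \<le> n \<Longrightarrow> exp (- \<mu> * (\<Sum>k<n. \<alpha> (T + k))) * m T < r / 2"
    by (auto simp: eventually_sequentially)
  have "norm (m t - 0) < r" if "T + N \<le> t" for t
  proof -
    have "T + (t - T) = t" "N \<le> t - T" using that by auto
    with bound[of "t - T"] N[of "t - T"] assms(1)[of t] show ?thesis by simp
  qed
  then show "\<exists>n0. \<forall>t\<ge>n0. norm (m t - 0) < r" by blast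
qed

section \<open>One step of the algorithm\<close>

lemma norm_vec_le_sum: "norm (x :: 'a::real_inner ^ 'n::finite) \<le> (\<Sum>i\<in>UNIV. norm (x $ i))"
  unfolding norm_vec_def by (rule L2_set_le_sum) simp

lemma power2_norm_vec: "(norm (x :: 'a::real_inner ^ 'n::finite))\<^sup>2 = (\<Sum>i\<in>UNIV. (norm (x $ i))\<^sup>2)"
  by (simp add: power2_norm_eq_inner inner_vec_def)

lemma borel_measurable_vec_nth [measurable]:
  "(\<lambda>x :: 'a::real_normed_vector ^ 'n::finite. x $ i) \<in> borel_measurable borel"
  by (intro borel_measurable_continuous_onI continuous_intros)

lemma borel_measurable_vec_lambda:
  fixes g :: "'n::finite \<Rightarrow> 'a \<Rightarrow> 'b::euclidean_space"
  assumes "\<And>i. g i \<in> borel_measurable M"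
  shows "(\<lambda>\<omega>. \<chi> i. g i \<omega>) \<in> borel_measurable M"
  using assms by (subst borel_measurable_euclidean_space) (auto simp: Basis_vec_def inner_axis)

text \<open>Independence makes the joint law a product, and Fubini integrates the noise
  \<open>Y\<close> out first, which turns \<Psi> into \<phi>. In the application \<open>X\<close> is
  the past noise and \<open>w\<close> picks one entry of the fresh noise; the bound on
  \<open>h\<close> provides integrability.\<close>

lemma (in robust_nonlinearity) expectation_phi:
  assumes "prob_space M" and ind: "prob_space.indep_var M S X T Y"
    and W: "distributed M lborel (\<lambda>\<omega>. w (Y \<omega>)) (\<lambda>u. ennreal (p u))"
    and [measurable]: "h \<in> borel_measurable S" "d \<in> borel_measurable S" "w \<in> borel_measurable T"
    and bound: "\<And>\<omega>. \<omega> \<in> space M \<Longrightarrow> \<bar>h (X \<omega>)\<bar> \<le> R"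
  shows "(LINT \<omega>|M. h (X \<omega>) * \<Psi> (d (X \<omega>) + w (Y \<omega>))) = (LINT \<omega>|M. h (X \<omega>) * \<phi> (d (X \<omega>)))"
proof -
  interpret prob_space M by fact
  have [measurable]: "X \<in> measurable M S" "Y \<in> measurable M T"
    using indep_var_rv1[OF ind] indep_var_rv2[OF ind] by auto
  interpret X: prob_space "distr M S X" by (rule prob_space_distr) measurable
  interpret Y: prob_space "distr M T Y" by (rule prob_space_distr) measurable
  interpret XY: pair_prob_space "distr M S X" "distr M T Y" ..
  let ?g = "\<lambda>(x, y). h x * \<Psi> (d x + w y)"
  have joint: "distr M S X \<Otimes>\<^sub>M distr M T Y = distr M (S \<Otimes>\<^sub>M T) (\<lambda>\<omega>. (X \<omega>, Y \<omega>))"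
    using ind by (simp add: indep_var_distribution_eq)
  obtain c where c: "0 < c" "\<And>u. \<bar>\<Psi> u\<bar> \<le> c" using \<Psi>_bounded by blast
  have inner: "(LINT y|distr M T Y. h x * \<Psi> (d x + w y)) = h x * \<phi> (d x)" for x
  proof -
    have "(LINT y|distr M T Y. \<Psi> (d x + w y)) = (LINT \<omega>|M. \<Psi> (d x + w (Y \<omega>)))"
      by (subst integral_distr) auto
    also have "\<dots> = \<phi> (d x)"
      using distributed_integral[OF W, of "\<lambda>w. \<Psi> (d x + w)"] p_nonneg
      by (simp add: phi_def mult.commute)
    finally show ?thesis by simp
  qed
  have "integrable M (\<lambda>\<omega>. h (X \<omega>) * \<Psi> (d (X \<omega>) + w (Y \<omega>)))"
  proof (rule integrable_const_bound[where B = "R * c"])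
    show "AE \<omega> in M. norm (h (X \<omega>) * \<Psi> (d (X \<omega>) + w (Y \<omega>))) \<le> R * c"
      using bound c by (auto simp: abs_mult intro!: AE_I2 mult_mono) (meson abs_ge_zero bound order_trans)
  qed measurable
  then have "integrable (distr M S X \<Otimes>\<^sub>M distr M T Y) ?g"
    unfolding joint by (subst integrable_distr_eq) auto
  from XY.integral_fst'[OF this]
  have "(LINT \<omega>|M. h (X \<omega>) * \<Psi> (d (X \<omega>) + w (Y \<omega>)))
      = (LINT x|distr M S X. LINT y|distr M T Y. h x * \<Psi> (d x + w y))"
    unfolding joint by (simp add: integral_distr)
  also have "\<dots> = (LINT x|distr M S X. h x * \<phi> (d x))"
    by (simp only: inner)
  also have "\<dots> = (LINT \<omega>|M. h (X \<omega>) * \<phi> (d (X \<omega>)))"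
    by (subst integral_distr) auto
  finally show ?thesis .
qed

section \<open>Deterministic estimates on the network\<close>

locale noisy_network = robust_nonlinearity p \<Psi> for p \<Psi> +
  fixes E :: "'n::finite set set" and f :: "'n \<Rightarrow> real^'m::finite \<Rightarrow> real"
    and \<mu> L :: real and xstar :: "real^'m"
  assumes connected: "connected_graph E"
    and cost: "\<And>i. convex_cost (f i) \<mu> L"
    and minimizer: "\<And>y. (\<Sum>i\<in>UNIV. f i xstar) \<le> (\<Sum>i\<in>UNIV. f i y)"
begin

definition \<theta> :: "real^'m^'n" where "\<theta> = (\<chi> i. xstar)"

definition coupling :: "real^'m^'n \<Rightarrow> ('n \<times> 'n \<Rightarrow> real^'m) \<Rightarrow> real^'m^'n" where
  "coupling x v = (\<chi> i. \<Sum>j\<in>neighbors E i. componentwise \<Psi> (x $ i - x $ j + v (i, j)))"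

definition gradients :: "real^'m^'n \<Rightarrow> real^'m^'n" where
  "gradients x = (\<chi> i. grad (f i) (x $ i))"

definition disagreement :: "real^'m^'n \<Rightarrow> real" where
  "disagreement x = (\<Sum>(i, j)\<in>arcs E. norm (x $ i - x $ j))"

definition dissipation :: "real^'m^'n \<Rightarrow> real" where
  "dissipation x = (\<Sum>(i, j)\<in>arcs E. \<Sum>l\<in>UNIV. (x $ i $ l - x $ j $ l) * \<phi> (x $ i $ l - x $ j $ l))"

lemma \<mu>_pos: "0 < \<mu>" and L_pos: "0 < L"
  using cost convex_cost.\<mu>_pos convex_cost.L_pos by blast+

lemma arcs_swap: "(i, j) \<in> arcs E \<longleftrightarrow> (j, i) \<in> arcs E"
  by (simp add: arcs_def insert_commute)

lemma sum_arcs: "(\<Sum>i\<in>UNIV. \<Sum>j\<in>neighbors E i. g i j) = (\<Sum>(i, j)\<in>arcs E. g i j)"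
proof -
  have "arcs E = (SIGMA i:UNIV. neighbors E i)"
    by (auto simp: arcs_def neighbors_def)
  then show ?thesis by (simp add: sum.Sigma)
qed

lemma sum_arcs_swap: "(\<Sum>(i, j)\<in>arcs E. g i j) = (\<Sum>(i, j)\<in>arcs E. g j i)"
  by (rule sum.reindex_bij_witness[of _ prod.swap prod.swap]) (auto simp: arcs_swap)

lemma inner_coupling:
  "(x - \<theta>) \<bullet> coupling x v
    = (\<Sum>(i, j)\<in>arcs E. \<Sum>l\<in>UNIV. (x $ i $ l - xstar $ l) * \<Psi> (x $ i $ l - x $ j $ l + v (i, j) $ l))"
proof -
  have "(x - \<theta>) \<bullet> coupling x v
      = (\<Sum>i\<in>UNIV. \<Sum>j\<in>neighbors E i. (x $ i - xstar) \<bullet> componentwise \<Psi> (x $ i - x $ j + v (i, j)))"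
    unfolding inner_vec_def[of "x - \<theta>"] by (simp add: coupling_def \<theta>_def inner_sum_right)
  then show ?thesis
    unfolding sum_arcs by (simp add: inner_vec_def componentwise_def)
qed

text \<open>Every edge occurs in both orientations. Exchanging them and using that \<phi> is odd
  gives a second form of the sum, weighted by the other endpoint with a minus sign; adding the two
  forms cancels \<open>xstar\<close>.\<close>

lemma dissipation_eq:
  "(\<Sum>(i, j)\<in>arcs E. \<Sum>l\<in>UNIV. (x $ i $ l - xstar $ l) * \<phi> (x $ i $ l - x $ j $ l)) = dissipation x / 2"
  (is "?Q = _")
proof -
  let ?Q' = "\<Sum>(i, j)\<in>arcs E. \<Sum>l\<in>UNIV. - (x $ j $ l - xstar $ l) * \<phi> (x $ i $ l - x $ j $ l)"
  have "(x $ j $ l - xstar $ l) * \<phi> (x $ j $ l - x $ i $ l) = - (x $ j $ l - xstar $ l) * \<phi> (x $ i $ l - x $ j $ l)"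
    for i j l using phi_odd[of "x $ i $ l - x $ j $ l"] by (simp add: algebra_simps)
  then have "?Q = ?Q'"
    by (subst sum_arcs_swap) (simp only:)
  then have "2 * ?Q = ?Q + ?Q'" by simp
  also have "\<dots> = dissipation x"
    unfolding dissipation_def sum.distrib[symmetric] split_def
    by (intro sum.cong refl) (simp only: distrib_right[symmetric], simp)
  finally show ?thesis by simp
qed

lemma dissipation_nonneg: "0 \<le> dissipation x"
  unfolding dissipation_def by (intro sum_nonneg) (auto intro!: sum_nonneg mult_phi_nonneg)

lemma disagreement_le_dissipation:
  assumes "0 < \<epsilon>"
  shows "disagreement x \<le> real (card (arcs E)) * real CARD('m) * \<epsilon> + dissipation x / \<phi> \<epsilon>"
proof -
  have "disagreement x \<le> (\<Sum>(i, j)\<in>arcs E. \<Sum>l\<in>UNIV.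
      \<epsilon> + (x $ i $ l - x $ j $ l) * \<phi> (x $ i $ l - x $ j $ l) / \<phi> \<epsilon>)"
    unfolding disagreement_def
  proof (intro sum_mono, clarify)
    fix i j
    have "norm (x $ i - x $ j) \<le> (\<Sum>l\<in>UNIV. \<bar>x $ i $ l - x $ j $ l\<bar>)"
      using norm_le_l1_cart[of "x $ i - x $ j"] by simp
    also have "\<dots> \<le> (\<Sum>l\<in>UNIV. \<epsilon> + (x $ i $ l - x $ j $ l) * \<phi> (x $ i $ l - x $ j $ l) / \<phi> \<epsilon>)"
      by (intro sum_mono abs_le_phi assms)
    finally show "norm (x $ i - x $ j)
      \<le> (\<Sum>l\<in>UNIV. \<epsilon> + (x $ i $ l - x $ j $ l) * \<phi> (x $ i $ l - x $ j $ l) / \<phi> \<epsilon>)" .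
  qed
  also have "\<dots> = real (card (arcs E)) * real CARD('m) * \<epsilon> + dissipation x / \<phi> \<epsilon>"
    by (simp add: sum.distrib split_def dissipation_def sum_divide_distrib)
  finally show ?thesis .
qed

lemma sum_grad_eq_0: "(\<Sum>i\<in>UNIV. grad (f i) xstar) = 0"
proof -
  have "((\<lambda>x. \<Sum>i\<in>UNIV. f i x) has_derivative (\<lambda>h. \<Sum>i\<in>UNIV. h \<bullet> grad (f i) xstar)) (at xstar)"
    using convex_cost.has_grad[OF cost] by (intro has_derivative_sum) (simp add: gderiv_def)
  then have "(\<lambda>h. \<Sum>i\<in>UNIV. h \<bullet> grad (f i) xstar) = (\<lambda>h. 0)"
    by (rule has_derivative_local_min) (simp add: minimizer)
  then have "h \<bullet> (\<Sum>i\<in>UNIV. grad (f i) xstar) = 0" for h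
    by (simp add: inner_sum_right fun_eq_iff)
  then show ?thesis using inner_eq_zero_iff by blast
qed

lemma gradients_lipschitz: "norm (gradients x - gradients y) \<le> L * norm (x - y)"
proof -
  have "(norm (gradients x - gradients y))\<^sup>2 \<le> (\<Sum>i\<in>UNIV. (L * norm (x $ i - y $ i))\<^sup>2)"
    unfolding power2_norm_vec[of "gradients x - gradients y"]
    by (intro sum_mono power_mono) (auto simp: gradients_def convex_cost.grad_lipschitz[OF cost])
  also have "\<dots> = (L * norm (x - y))\<^sup>2"
    unfolding power_mult_distrib sum_distrib_left[symmetric] power2_norm_vec[of "x - y"] by simp
  finally show ?thesis
    by (rule power2_le_imp_le) (use L_pos in simp)
qed

text \<open>Strong monotonicity about \<theta> leaves the inner product with the gradients at
  \<theta>, which need not vanish individually. As they sum to 0, \<open>xstar\<close> may be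
  replaced by the state of any one agent, and differences of states are controlled by the
  disagreement.\<close>

lemma inner_gradients_ge:
  obtains \<kappa> where "0 \<le> \<kappa>"
    "\<And>x. \<mu> * (norm (x - \<theta>))\<^sup>2 - \<kappa> * disagreement x \<le> (x - \<theta>) \<bullet> gradients x"
proof -
  obtain C where C: "0 \<le> C"
      "\<And>(y :: 'n \<Rightarrow> real^'m) i j. norm (y i - y j) \<le> C * (\<Sum>(k, l)\<in>arcs E. norm (y k - y l))"
    using connected_graph_difference_bound[OF connected] by blast
  define \<kappa> where "\<kappa> = C * (\<Sum>i\<in>UNIV. norm (grad (f i) xstar))"
  have "\<mu> * (norm (x - \<theta>))\<^sup>2 - \<kappa> * disagreement x \<le> (x - \<theta>) \<bullet> gradients x" for x
  proof -
    have "\<mu> * (norm (x - \<theta>))\<^sup>2 \<le> (x - \<theta>) \<bullet> (gradients x - gradients \<theta>)"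
      unfolding power2_norm_vec[of "x - \<theta>"] sum_distrib_left inner_vec_def[of "x - \<theta>"]
      by (intro sum_mono) (auto simp: gradients_def convex_cost.grad_strongly_monotone[OF cost])
    moreover have "- (\<kappa> * disagreement x) \<le> (x - \<theta>) \<bullet> gradients \<theta>"
    proof -
      fix k :: 'n
      have "(x - \<theta>) \<bullet> gradients \<theta> = (\<Sum>i\<in>UNIV. (x $ i - xstar) \<bullet> grad (f i) xstar)"
        unfolding inner_vec_def[of "x - \<theta>"] by (simp add: gradients_def \<theta>_def)
      also have "\<dots> = (\<Sum>i\<in>UNIV. (x $ i - x $ k) \<bullet> grad (f i) xstar) + (x $ k - xstar) \<bullet> (\<Sum>i\<in>UNIV. grad (f i) xstar)"
        by (simp add: inner_sum_right sum.distrib[symmetric] inner_simps)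
      also have "\<dots> = (\<Sum>i\<in>UNIV. (x $ i - x $ k) \<bullet> grad (f i) xstar)"
        by (simp add: sum_grad_eq_0)
      also have "- \<dots> \<le> (\<Sum>i\<in>UNIV. norm (x $ i - x $ k) * norm (grad (f i) xstar))"
        unfolding sum_negf[symmetric]
        by (intro sum_mono) (metis abs_le_D2 Cauchy_Schwarz_ineq2)
      also have "\<dots> \<le> (\<Sum>i\<in>UNIV. (C * disagreement x) * norm (grad (f i) xstar))"
        unfolding disagreement_def by (intro sum_mono mult_right_mono C(2)) simp
      also have "\<dots> = \<kappa> * disagreement x"
        by (simp add: \<kappa>_def sum_distrib_left sum_distrib_right mult_ac)
      finally show ?thesis by simp
    qed
    ultimately show ?thesis by (simp add: inner_diff_right)
  qed
  moreover have "0 \<le> \<kappa>" using C by (simp add: \<kappa>_def sum_nonneg)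
  ultimately show ?thesis using that by blast
qed

text \<open>Since \<Psi> is bounded, the bound is uniform in the state and in the noise. Hence the
  squared coupling has a finite mean even if the noise variance is infinite.\<close>

lemma norm_coupling_le:
  obtains C where "0 \<le> C" "\<And>x v. norm (coupling x v) \<le> C"
proof -
  obtain c where c: "0 < c" "\<And>u. \<bar>\<Psi> u\<bar> \<le> c" using \<Psi>_bounded by blast
  define C where "C = (\<Sum>i\<in>UNIV. \<Sum>j\<in>neighbors E i. \<Sum>l\<in>(UNIV :: 'm set). c)"
  have "norm (componentwise \<Psi> (u :: real^'m)) \<le> (\<Sum>l\<in>(UNIV :: 'm set). c)" for u
    using c(2) by (intro order_trans[OF norm_le_l1_cart sum_mono]) (simp add: componentwise_def)
  then have "norm (coupling x v) \<le> C" for x v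
    unfolding C_def coupling_def
    by - (rule order_trans[OF norm_vec_le_sum sum_mono], simp only: vec_lambda_beta sum_norm_le)
  moreover have "0 \<le> C" unfolding C_def using c by (intro sum_nonneg) auto
  ultimately show ?thesis using that by blast
qed

definition step :: "real \<Rightarrow> real \<Rightarrow> real^'m^'n \<Rightarrow> ('n \<times> 'n \<Rightarrow> real^'m) \<Rightarrow> real^'m^'n" where
  "step \<alpha> \<beta> x v = x - \<beta> *\<^sub>R coupling x v - \<alpha> *\<^sub>R gradients x"

lemma iterate_Suc:
  "iterate E f \<Psi> \<alpha> \<beta> \<xi> x0 (Suc t) \<omega>
    = step (\<alpha> t) (\<beta> t) (iterate E f \<Psi> \<alpha> \<beta> \<xi> x0 t \<omega>) (\<lambda>e. \<xi> t e \<omega>)"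
  by (simp add: step_def coupling_def gradients_def vec_eq_iff Let_def)

text \<open>The square is expanded, and its quadratic part is split twice by the inequality
  \<open>sq\<close>, whence the factors 4. The cross term with the coupling stays as it is, because
  its sign appears only after averaging over the noise.\<close>

lemma step_descent:
  obtains \<kappa> where "0 \<le> \<kappa>"
    "\<And>\<alpha> \<beta> x v. 0 \<le> \<alpha> \<Longrightarrow> (norm (step \<alpha> \<beta> x v - \<theta>))\<^sup>2
      \<le> (1 - 2 * \<alpha> * \<mu> + 4 * \<alpha>\<^sup>2 * L\<^sup>2) * (norm (x - \<theta>))\<^sup>2 - 2 * \<beta> * ((x - \<theta>) \<bullet> coupling x v)
        + 2 * \<alpha> * \<kappa> * disagreement x + 2 * \<beta>\<^sup>2 * (norm (coupling x v))\<^sup>2 + 4 * \<alpha>\<^sup>2 * (norm (gradients \<theta>))\<^sup>2"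
proof -
  obtain \<kappa> where \<kappa>: "0 \<le> \<kappa>"
      "\<And>x. \<mu> * (norm (x - \<theta>))\<^sup>2 - \<kappa> * disagreement x \<le> (x - \<theta>) \<bullet> gradients x"
    using inner_gradients_ge by blast
  have sq: "(norm (u + v))\<^sup>2 \<le> 2 * (norm u)\<^sup>2 + 2 * (norm v)\<^sup>2" for u v :: "real^'m^'n"
  proof -
    have "(norm (u + v))\<^sup>2 \<le> (norm u + norm v)\<^sup>2"
      by (intro power_mono norm_triangle_ineq) simp
    also have "\<dots> \<le> 2 * (norm u)\<^sup>2 + 2 * (norm v)\<^sup>2"
      using sum_squares_bound[of "norm u" "norm v"] by (simp add: power2_sum)
    finally show ?thesis .
  qed
  have "(norm (step \<alpha> \<beta> x v - \<theta>))\<^sup>2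
      \<le> (1 - 2 * \<alpha> * \<mu> + 4 * \<alpha>\<^sup>2 * L\<^sup>2) * (norm (x - \<theta>))\<^sup>2 - 2 * \<beta> * ((x - \<theta>) \<bullet> coupling x v)
        + 2 * \<alpha> * \<kappa> * disagreement x + 2 * \<beta>\<^sup>2 * (norm (coupling x v))\<^sup>2 + 4 * \<alpha>\<^sup>2 * (norm (gradients \<theta>))\<^sup>2"
    if "0 \<le> \<alpha>" for \<alpha> \<beta> x v
  proof -
    let ?e = "x - \<theta>" and ?U = "coupling x v" and ?g = "gradients x"
    have eq: "(norm (step \<alpha> \<beta> x v - \<theta>))\<^sup>2
        = (norm ?e)\<^sup>2 - 2 * \<beta> * (?e \<bullet> ?U) - 2 * \<alpha> * (?e \<bullet> ?g) + (norm (\<beta> *\<^sub>R ?U + \<alpha> *\<^sub>R ?g))\<^sup>2"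
    proof -
      have "step \<alpha> \<beta> x v - \<theta> = ?e - (\<beta> *\<^sub>R ?U + \<alpha> *\<^sub>R ?g)"
        by (simp add: step_def algebra_simps)
      then show ?thesis
        by (simp only: power2_norm_eq_inner) (simp add: inner_simps inner_commute algebra_simps)
    qed
    have "(norm (\<beta> *\<^sub>R ?U + \<alpha> *\<^sub>R ?g))\<^sup>2 \<le> 2 * \<beta>\<^sup>2 * (norm ?U)\<^sup>2 + 2 * \<alpha>\<^sup>2 * (norm ?g)\<^sup>2"
      using sq[of "\<beta> *\<^sub>R ?U" "\<alpha> *\<^sub>R ?g"] by (simp add: power_mult_distrib)
    also have "(norm ?g)\<^sup>2 \<le> 2 * (L * norm ?e)\<^sup>2 + 2 * (norm (gradients \<theta>))\<^sup>2"
      using sq[of "?g - gradients \<theta>" "gradients \<theta>"]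
        power_mono[OF gradients_lipschitz[of x \<theta>] norm_ge_zero, of 2] by simp
    finally have quad: "(norm (\<beta> *\<^sub>R ?U + \<alpha> *\<^sub>R ?g))\<^sup>2
        \<le> 2 * \<beta>\<^sup>2 * (norm ?U)\<^sup>2 + 2 * \<alpha>\<^sup>2 * (2 * (L * norm ?e)\<^sup>2 + 2 * (norm (gradients \<theta>))\<^sup>2)"
      by (simp add: mult_left_mono)
    have "2 * \<alpha> * (\<mu> * (norm ?e)\<^sup>2 - \<kappa> * disagreement x) \<le> 2 * \<alpha> * (?e \<bullet> ?g)"
      using \<kappa>(2)[of x] that by (intro mult_left_mono) auto
    with eq quad show ?thesis
      by (simp add: power_mult_distrib algebra_simps)
  qed
  with \<kappa>(1) show ?thesis using that by blast
qed

end

section \<open>The mean-squared error\<close>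

text \<open>The state at time \<open>t\<close> depends only on earlier noise on the arcs. The two
  runs may live on different sample spaces, which allows passing from the probability space to the
  product space of past noise values.\<close>

lemma iterate_cong:
  assumes "\<And>s e. s < t \<Longrightarrow> e \<in> arcs E \<Longrightarrow> \<xi> s e \<omega> = \<xi>' s e \<omega>'"
  shows "iterate E f \<Psi> \<alpha> \<beta> \<xi> x0 t \<omega> = iterate E f \<Psi> \<alpha> \<beta> \<xi>' x0 t \<omega>'"
  using assms
proof (induction t)
  case (Suc t)
  have "iterate E f \<Psi> \<alpha> \<beta> \<xi> x0 t \<omega> = iterate E f \<Psi> \<alpha> \<beta> \<xi>' x0 t \<omega>'"
    using Suc by simp
  moreover have "\<xi> t (i, j) \<omega> = \<xi>' t (i, j) \<omega>'" if "j \<in> neighbors E i" for i j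
    using that Suc.prems[of t "(i, j)"] by (simp add: arcs_def neighbors_def)
  ultimately show ?case
    unfolding iterate.simps Let_def by (simp only: cong: sum.cong)
qed simp

section \<open>Expectations along the iterates\<close>

context noisy_network
begin

lemma componentwise_measurable [measurable]: "componentwise \<Psi> \<in> borel_measurable borel"
  unfolding componentwise_def by (intro borel_measurable_vec_lambda) measurable

lemma grad_measurable [measurable]: "grad (f i) \<in> borel_measurable borel"
  using convex_cost.grad_continuous[OF cost] by (rule borel_measurable_continuous_onI)

text \<open>The measure and the noise are arbitrary because this is applied both on the probability
  space and on the product space of past noise values.\<close>

lemma iterate_measurable:
  assumes "\<And>s e. s < t \<Longrightarrow> e \<in> arcs E \<Longrightarrow> \<xi> s e \<in> borel_measurable M"
  shows "iterate E f \<Psi> \<alpha> \<beta> \<xi> x0 t \<in> borel_measurable M"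
  using assms
proof (induction t)
  case (Suc t)
  have [measurable]: "iterate E f \<Psi> \<alpha> \<beta> \<xi> x0 t \<in> borel_measurable M"
    using Suc by simp
  have [measurable]: "\<xi> t (i, j) \<in> borel_measurable M" if "j \<in> neighbors E i" for i j
    using that Suc.prems[of t "(i, j)"] by (simp add: arcs_def neighbors_def)
  show ?case
    unfolding iterate.simps Let_def
    by (intro borel_measurable_vec_lambda borel_measurable_diff borel_measurable_scaleR
        borel_measurable_sum borel_measurable_const) measurable
qed simp

text \<open>Each step adds a bounded coupling and a gradient of at most linear growth. The bound may
  grow with \<open>t\<close> but is uniform in the sample point, so it yields integrability at each
  fixed time.\<close>

lemma iterate_bounded:
  obtains R where "\<And>\<omega>. norm (iterate E f \<Psi> \<alpha> \<beta> \<xi> x0 t \<omega> - \<theta>) \<le> R"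
proof (induction t arbitrary: thesis)
  case 0
  show ?case by (rule 0[of "norm (x0 - \<theta>)"]) simp
next
  case (Suc t)
  obtain R where R: "\<And>\<omega>. norm (iterate E f \<Psi> \<alpha> \<beta> \<xi> x0 t \<omega> - \<theta>) \<le> R"
    using Suc.IH by blast
  obtain C where C: "0 \<le> C" "\<And>x v. norm (coupling x v) \<le> C"
    using norm_coupling_le by blast
  have "norm (iterate E f \<Psi> \<alpha> \<beta> \<xi> x0 (Suc t) \<omega> - \<theta>)
      \<le> R + \<bar>\<beta> t\<bar> * C + \<bar>\<alpha> t\<bar> * (L * R + norm (gradients \<theta>))" for \<omega>
  proof -
    let ?x = "iterate E f \<Psi> \<alpha> \<beta> \<xi> x0 t \<omega>"
    let ?U = "coupling ?x (\<lambda>e. \<xi> t e \<omega>)"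
    have "norm (gradients ?x) \<le> norm (gradients ?x - gradients \<theta>) + norm (gradients \<theta>)"
      using norm_triangle_ineq[of "gradients ?x - gradients \<theta>" "gradients \<theta>"] by simp
    also have "\<dots> \<le> L * R + norm (gradients \<theta>)"
      using gradients_lipschitz[of ?x \<theta>] R[of \<omega>] L_pos
      by (meson add_right_mono less_imp_le mult_left_mono order_trans)
    finally have g: "\<bar>\<alpha> t\<bar> * norm (gradients ?x) \<le> \<bar>\<alpha> t\<bar> * (L * R + norm (gradients \<theta>))"
      by (rule mult_left_mono) simp
    have eq: "iterate E f \<Psi> \<alpha> \<beta> \<xi> x0 (Suc t) \<omega> - \<theta> = (?x - \<theta>) - \<beta> t *\<^sub>R ?U - \<alpha> t *\<^sub>R gradients ?x"
      unfolding iterate_Suc step_def by simp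
    have "norm (iterate E f \<Psi> \<alpha> \<beta> \<xi> x0 (Suc t) \<omega> - \<theta>) \<le> norm (?x - \<theta>) + norm (\<beta> t *\<^sub>R ?U) + norm (\<alpha> t *\<^sub>R gradients ?x)"
      unfolding eq
      using norm_triangle_ineq4[of "?x - \<theta> - \<beta> t *\<^sub>R ?U" "\<alpha> t *\<^sub>R gradients ?x"]
        norm_triangle_ineq4[of "?x - \<theta>" "\<beta> t *\<^sub>R ?U"] by linarith
    also have "\<dots> \<le> R + \<bar>\<beta> t\<bar> * C + \<bar>\<alpha> t\<bar> * (L * R + norm (gradients \<theta>))"
      unfolding norm_scaleR by (intro add_mono R g mult_left_mono C) simp
    finally show ?thesis .
  qed
  then show ?case by (rule Suc.prems)
qed

lemma expectation_noisy_difference: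
  fixes M :: "'p measure" and \<alpha> \<beta> :: "nat \<Rightarrow> real" and x0 :: "real^'m^'n" and t :: nat
  assumes noise: "iid_noise M (arcs E) p \<xi>" and e: "e \<in> arcs E"
  defines "X \<equiv> iterate E f \<Psi> \<alpha> \<beta> \<xi> x0 t"
  assumes [measurable]: "h \<in> borel_measurable borel" "d \<in> borel_measurable borel"
    and bound: "\<And>\<omega>. \<bar>h (X \<omega>)\<bar> \<le> R"
  shows "(LINT \<omega>|M. h (X \<omega>) * \<Psi> (d (X \<omega>) + \<xi> t e \<omega> $ l)) = (LINT \<omega>|M. h (X \<omega>) * \<phi> (d (X \<omega>)))"
proof -
  interpret prob_space M using noise by (simp add: iid_noise_def)
  let ?A = "{..<t} \<times> arcs E" and ?B = "{(t, e)}" and ?N = "\<lambda>_ :: nat \<times> 'n \<times> 'n. borel :: (real^'m) measure"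
  let ?\<xi> = "\<lambda>(t, e). \<xi> t e"
  \<comment> \<open>The algorithm driven by the coordinates of the product space: this exhibits the
    state at time \<open>t\<close> as a function of the past noise.\<close>
  let ?F = "iterate E f \<Psi> \<alpha> \<beta> (\<lambda>s e w. w (s, e)) x0 t"
  let ?past = "\<lambda>\<omega>. restrict (\<lambda>i. ?\<xi> i \<omega>) ?A" and ?now = "\<lambda>\<omega>. restrict (\<lambda>i. ?\<xi> i \<omega>) ?B"
  have "indep_vars ?N ?\<xi> (UNIV \<times> arcs E)"
    using noise by (simp add: iid_noise_def)
  \<comment> \<open>The index sets are disjoint since one contains only times before
    \<open>t\<close>, so grouping preserves independence.\<close>
  then have ind: "indep_var (PiM ?A ?N) ?past (PiM ?B ?N) ?now"
    by (rule indep_var_restrict) (use e in auto)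
  have [measurable]: "?F \<in> borel_measurable (PiM ?A ?N)"
    by (rule iterate_measurable) (simp add: measurable_component_singleton)
  have "(\<lambda>w. w (t, e)) \<in> PiM ?B ?N \<rightarrow>\<^sub>M borel"
    by (rule measurable_component_singleton) simp
  from measurable_compose[OF this borel_measurable_vec_nth]
  have now: "(\<lambda>w. w (t, e) $ l) \<in> borel_measurable (PiM ?B ?N)" .
  have F: "?F (?past \<omega>) = X \<omega>" for \<omega>
    unfolding X_def by (rule iterate_cong) auto
  have "distributed M lborel (\<lambda>\<omega>. ?now \<omega> (t, e) $ l) (\<lambda>u. ennreal (p u))"
    using noise e by (simp add: iid_noise_def)
  from expectation_phi[OF prob_space_axioms ind this _ _ now, of "\<lambda>w. h (?F w)" "\<lambda>w. d (?F w)" R]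
  show ?thesis
    unfolding F by (simp add: bound)
qed

lemma noise_measurable:
  assumes "iid_noise M (arcs E) p \<xi>" "e \<in> arcs E"
  shows "\<xi> t e \<in> borel_measurable M"
proof -
  interpret prob_space M using assms by (simp add: iid_noise_def)
  have "indep_vars (\<lambda>_. borel) (\<lambda>(t, e). \<xi> t e) (UNIV \<times> arcs E)"
    using assms by (simp add: iid_noise_def)
  then show ?thesis
    using assms(2) by (auto simp: indep_vars_def)
qed

text \<open>Arc by arc and entry by entry, the fresh noise is averaged out against the past state,
  replacing \<Psi> by \<phi>; the resulting sum is half the dissipation.\<close>

lemma expectation_coupling:
  fixes M :: "'p measure" and \<alpha> \<beta> :: "nat \<Rightarrow> real" and x0 :: "real^'m^'n" and t :: nat
  assumes noise: "iid_noise M (arcs E) p \<xi>"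
  defines "X \<equiv> iterate E f \<Psi> \<alpha> \<beta> \<xi> x0 t"
  shows "integrable M (\<lambda>\<omega>. (X \<omega> - \<theta>) \<bullet> coupling (X \<omega>) (\<lambda>e. \<xi> t e \<omega>))"
    and "integrable M (\<lambda>\<omega>. dissipation (X \<omega>))"
    and "(LINT \<omega>|M. (X \<omega> - \<theta>) \<bullet> coupling (X \<omega>) (\<lambda>e. \<xi> t e \<omega>)) = (LINT \<omega>|M. dissipation (X \<omega>)) / 2"
proof -
  interpret prob_space M using noise by (simp add: iid_noise_def)
  have [measurable]: "X \<in> borel_measurable M"
    unfolding X_def using noise by (intro iterate_measurable noise_measurable)
  obtain R where R: "\<And>\<omega>. norm (X \<omega> - \<theta>) \<le> R"
    unfolding X_def using iterate_bounded by blast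
  have bound: "\<bar>X \<omega> $ i $ l - xstar $ l\<bar> \<le> R" for \<omega> i l
  proof -
    have "\<bar>X \<omega> $ i $ l - xstar $ l\<bar> = \<bar>(X \<omega> - \<theta>) $ i $ l\<bar>" by (simp add: \<theta>_def)
    also have "\<dots> \<le> norm ((X \<omega> - \<theta>) $ i)" by (rule component_le_norm_cart)
    also have "\<dots> \<le> norm (X \<omega> - \<theta>)" by (rule Finite_Cartesian_Product.norm_nth_le)
    finally show ?thesis using R[of \<omega>] by simp
  qed
  obtain c where c: "0 < c" "\<And>u. \<bar>\<Psi> u\<bar> \<le> c" using \<Psi>_bounded by blast
  have int: "integrable M (\<lambda>\<omega>. (X \<omega> $ i $ l - xstar $ l) * h \<omega>)"
    if [measurable]: "h \<in> borel_measurable M" and "\<And>\<omega>. \<bar>h \<omega>\<bar> \<le> c" for i l h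
    by (rule integrable_const_bound[where B = "R * c"])
      (auto simp: abs_mult bound that(2) intro!: AE_I2 mult_mono intro: order_trans[OF abs_ge_zero bound])
  have [measurable]: "\<xi> t e \<in> borel_measurable M" if "e \<in> arcs E" for e
    using noise_measurable[OF noise that] .
  have int1: "integrable M (\<lambda>\<omega>. (X \<omega> $ i $ l - xstar $ l) * \<Psi> (X \<omega> $ i $ l - X \<omega> $ j $ l + \<xi> t (i, j) \<omega> $ l))"
    if "(i, j) \<in> arcs E" for i j l
    by (rule int) (use that c in measurable)
  have int2: "integrable M (\<lambda>\<omega>. (X \<omega> $ i $ l - xstar $ l) * \<phi> (X \<omega> $ i $ l - X \<omega> $ j $ l))" for i j l
    by (rule int) (use phi_bounded[OF c(2)] in measurable)
  show "integrable M (\<lambda>\<omega>. (X \<omega> - \<theta>) \<bullet> coupling (X \<omega>) (\<lambda>e. \<xi> t e \<omega>))"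
    unfolding inner_coupling using int1 by (auto intro!: Bochner_Integration.integrable_sum)
  have "integrable M (\<lambda>\<omega>. \<Sum>(i, j)\<in>arcs E. \<Sum>l\<in>UNIV. (X \<omega> $ i $ l - xstar $ l) * \<phi> (X \<omega> $ i $ l - X \<omega> $ j $ l))"
    using int2 by (auto intro!: Bochner_Integration.integrable_sum)
  then have "integrable M (\<lambda>\<omega>. 2 * (dissipation (X \<omega>) / 2))"
    unfolding dissipation_eq by (rule integrable_mult_right)
  then show "integrable M (\<lambda>\<omega>. dissipation (X \<omega>))"
    by simp
  have "(LINT \<omega>|M. (X \<omega> $ i $ l - xstar $ l) * \<Psi> (X \<omega> $ i $ l - X \<omega> $ j $ l + \<xi> t (i, j) \<omega> $ l))
      = (LINT \<omega>|M. (X \<omega> $ i $ l - xstar $ l) * \<phi> (X \<omega> $ i $ l - X \<omega> $ j $ l))" if "(i, j) \<in> arcs E" for i j l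
  proof -
    show ?thesis
      using expectation_noisy_difference[OF noise that, of "\<lambda>x. x $ i $ l - xstar $ l" "\<lambda>x. x $ i $ l - x $ j $ l" \<alpha> \<beta> x0 t R l]
        bound by (simp add: X_def)
  qed
  from this[of "fst e" "snd e" for e] have "(LINT \<omega>|M. (X \<omega> - \<theta>) \<bullet> coupling (X \<omega>) (\<lambda>e. \<xi> t e \<omega>))
      = (LINT \<omega>|M. (\<Sum>(i, j)\<in>arcs E. \<Sum>l\<in>UNIV. (X \<omega> $ i $ l - xstar $ l) * \<phi> (X \<omega> $ i $ l - X \<omega> $ j $ l)))"
    unfolding inner_coupling split_def
    using int1[of "fst e" "snd e" for e] int2 by (simp add: Bochner_Integration.integral_sum cong: sum.cong)
  then show "(LINT \<omega>|M. (X \<omega> - \<theta>) \<bullet> coupling (X \<omega>) (\<lambda>e. \<xi> t e \<omega>)) = (LINT \<omega>|M. dissipation (X \<omega>)) / 2"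
    unfolding dissipation_eq by simp
qed

lemma error_integrable:
  assumes noise: "iid_noise M (arcs E) p \<xi>"
  shows "integrable M (\<lambda>\<omega>. (norm (iterate E f \<Psi> \<alpha> \<beta> \<xi> x0 t \<omega> - \<theta>))\<^sup>2)"
proof -
  interpret prob_space M using noise by (simp add: iid_noise_def)
  have [measurable]: "iterate E f \<Psi> \<alpha> \<beta> \<xi> x0 t \<in> borel_measurable M"
    using noise by (intro iterate_measurable noise_measurable)
  obtain R where R: "\<And>\<omega>. norm (iterate E f \<Psi> \<alpha> \<beta> \<xi> x0 t \<omega> - \<theta>) \<le> R"
    using iterate_bounded by blast
  show ?thesis
    by (rule integrable_const_bound[where B = "R\<^sup>2"]) (auto simp: R intro!: AE_I2 power_mono)
qed

section \<open>Recursion and convergence of the mean-squared error\<close>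

definition mse :: "(nat \<Rightarrow> real) \<Rightarrow> (nat \<Rightarrow> real) \<Rightarrow> 'p measure \<Rightarrow> (nat \<Rightarrow> 'n \<times> 'n \<Rightarrow> 'p \<Rightarrow> real^'m) \<Rightarrow> real^'m^'n \<Rightarrow> nat \<Rightarrow> real" where
  "mse \<alpha> \<beta> M \<xi> x0 t = (LINT \<omega>|M. (norm (iterate E f \<Psi> \<alpha> \<beta> \<xi> x0 t \<omega> - \<theta>))\<^sup>2)"

lemma mse_nonneg: "0 \<le> mse \<alpha> \<beta> M \<xi> x0 t"
  unfolding mse_def by (rule Bochner_Integration.integral_nonneg) simp

text \<open>The coupling contributes - \<beta> times the mean dissipation, while the disagreement
  contributes a multiple of \<alpha> / \<phi>(\<epsilon>) times it. The smallness condition makes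
  the sum nonpositive. The constants precede step sizes, noise and \<epsilon>.\<close>

lemma mse_recursion:
  obtains \<kappa> C D where "0 \<le> \<kappa>" "0 \<le> C" "0 \<le> D"
    "\<And>\<alpha> \<beta> (M :: 'p measure) \<xi> x0 t \<epsilon>. iid_noise M (arcs E) p \<xi> \<Longrightarrow> 0 \<le> \<alpha> t \<Longrightarrow> 0 < \<epsilon> \<Longrightarrow> \<alpha> t * \<kappa> * 2 \<le> \<beta> t * \<phi> \<epsilon> \<Longrightarrow>
      mse \<alpha> \<beta> M \<xi> x0 (Suc t) \<le> (1 - 2 * \<alpha> t * \<mu> + 4 * (\<alpha> t)\<^sup>2 * L\<^sup>2) * mse \<alpha> \<beta> M \<xi> x0 t
        + \<alpha> t * \<kappa> * \<epsilon> + C * (\<beta> t)\<^sup>2 + D * (\<alpha> t)\<^sup>2"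
proof -
  obtain \<kappa> where \<kappa>: "0 \<le> \<kappa>"
    "\<And>\<alpha> \<beta> x v. 0 \<le> \<alpha> \<Longrightarrow> (norm (step \<alpha> \<beta> x v - \<theta>))\<^sup>2
      \<le> (1 - 2 * \<alpha> * \<mu> + 4 * \<alpha>\<^sup>2 * L\<^sup>2) * (norm (x - \<theta>))\<^sup>2 - 2 * \<beta> * ((x - \<theta>) \<bullet> coupling x v)
        + 2 * \<alpha> * \<kappa> * disagreement x + 2 * \<beta>\<^sup>2 * (norm (coupling x v))\<^sup>2 + 4 * \<alpha>\<^sup>2 * (norm (gradients \<theta>))\<^sup>2"
    using step_descent by blast
  obtain C where C: "0 \<le> C" "\<And>x v. norm (coupling x v) \<le> C"
    using norm_coupling_le by blast
  define n where "n = real (card (arcs E)) * real CARD('m)"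
  \<comment> \<open>Enlarged so that one constant serves both the \<epsilon>-term, which carries the
    factor \<open>n\<close>, and the smallness condition, which also covers
    \<open>n = 0\<close>.\<close>
  define \<kappa>' where "\<kappa>' = 2 * \<kappa> * (n + 1)"
  have n: "0 \<le> n" by (simp add: n_def)
  have main: "mse \<alpha> \<beta> M \<xi> x0 (Suc t) \<le> (1 - 2 * \<alpha> t * \<mu> + 4 * (\<alpha> t)\<^sup>2 * L\<^sup>2) * mse \<alpha> \<beta> M \<xi> x0 t
      + \<alpha> t * \<kappa>' * \<epsilon> + 2 * C\<^sup>2 * (\<beta> t)\<^sup>2 + 4 * (norm (gradients \<theta>))\<^sup>2 * (\<alpha> t)\<^sup>2"
    if noise: "iid_noise M (arcs E) p \<xi>" and \<alpha>: "0 \<le> \<alpha> t" and \<epsilon>: "0 < \<epsilon>" and small: "\<alpha> t * \<kappa>' * 2 \<le> \<beta> t * \<phi> \<epsilon>"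
    for \<alpha> \<beta> and M :: "'p measure" and \<xi> x0 t \<epsilon>
  proof -
    interpret prob_space M using noise by (simp add: iid_noise_def)
    let ?X = "iterate E f \<Psi> \<alpha> \<beta> \<xi> x0"
    let ?q = "1 - 2 * \<alpha> t * \<mu> + 4 * (\<alpha> t)\<^sup>2 * L\<^sup>2"
    let ?U = "\<lambda>\<omega>. coupling (?X t \<omega>) (\<lambda>e. \<xi> t e \<omega>)"
    let ?r = "2 * \<alpha> t * \<kappa> * n * \<epsilon> + 2 * C\<^sup>2 * (\<beta> t)\<^sup>2 + 4 * (norm (gradients \<theta>))\<^sup>2 * (\<alpha> t)\<^sup>2"
    let ?k = "2 * \<alpha> t * \<kappa> / \<phi> \<epsilon>"
    note int = error_integrable[OF noise]
    note intU = expectation_coupling(1)[OF noise, of \<alpha> \<beta> x0 t]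
      and intP = expectation_coupling(2)[OF noise, of \<alpha> \<beta> x0 t]
      and EU = expectation_coupling(3)[OF noise, of \<alpha> \<beta> x0 t]
    have pointwise: "(norm (?X (Suc t) \<omega> - \<theta>))\<^sup>2
        \<le> ?q * (norm (?X t \<omega> - \<theta>))\<^sup>2 - 2 * \<beta> t * ((?X t \<omega> - \<theta>) \<bullet> ?U \<omega>) + ?k * dissipation (?X t \<omega>) + ?r" for \<omega>
    proof -
      have "2 * \<alpha> t * \<kappa> * disagreement (?X t \<omega>) \<le> 2 * \<alpha> t * \<kappa> * (n * \<epsilon> + dissipation (?X t \<omega>) / \<phi> \<epsilon>)"
        using \<alpha> \<kappa>(1) disagreement_le_dissipation[OF \<epsilon>, of "?X t \<omega>"] unfolding n_def
        by (intro mult_left_mono) auto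
      moreover have "2 * (\<beta> t)\<^sup>2 * (norm (?U \<omega>))\<^sup>2 \<le> 2 * (\<beta> t)\<^sup>2 * C\<^sup>2"
        using C by (intro mult_left_mono power_mono) auto
      ultimately show ?thesis
        using \<kappa>(2)[OF \<alpha>, of "\<beta> t" "?X t \<omega>" "\<lambda>e. \<xi> t e \<omega>"]
        unfolding iterate_Suc by (simp add: algebra_simps)
    qed
    have "mse \<alpha> \<beta> M \<xi> x0 (Suc t) \<le> (LINT \<omega>|M. ?q * (norm (?X t \<omega> - \<theta>))\<^sup>2
        - 2 * \<beta> t * ((?X t \<omega> - \<theta>) \<bullet> ?U \<omega>) + ?k * dissipation (?X t \<omega>) + ?r)"
      unfolding mse_def
      by (intro integral_mono pointwise int Bochner_Integration.integrable_add Bochner_Integration.integrable_diff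
          integrable_mult_right intU intP integrable_const)
    also have "\<dots> = ?q * mse \<alpha> \<beta> M \<xi> x0 t - 2 * \<beta> t * (LINT \<omega>|M. (?X t \<omega> - \<theta>) \<bullet> ?U \<omega>)
        + ?k * (LINT \<omega>|M. dissipation (?X t \<omega>)) + ?r"
      unfolding mse_def using int intU intP by (simp add: prob_space)
    also have "\<dots> = ?q * mse \<alpha> \<beta> M \<xi> x0 t + (?k - \<beta> t) * (LINT \<omega>|M. dissipation (?X t \<omega>)) + ?r"
      unfolding EU by (simp add: algebra_simps)
    also have "(?k - \<beta> t) * (LINT \<omega>|M. dissipation (?X t \<omega>)) \<le> 0"
    proof (intro mult_nonpos_nonneg Bochner_Integration.integral_nonneg dissipation_nonneg)
      have "2 * \<alpha> t * \<kappa> \<le> \<alpha> t * \<kappa>' * 2"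
        using \<alpha> \<kappa>(1) n by (simp add: \<kappa>'_def algebra_simps)
      also note small
      finally show "?k - \<beta> t \<le> 0"
        using phi_pos[OF \<epsilon>] by (simp add: pos_divide_le_eq)
    qed
    also have "2 * \<alpha> t * \<kappa> * n * \<epsilon> \<le> \<alpha> t * \<kappa>' * \<epsilon>"
      using \<alpha> \<kappa>(1) \<epsilon> by (simp add: \<kappa>'_def algebra_simps)
    finally show ?thesis by simp
  qed
  show ?thesis
    by (rule that[of \<kappa>' "2 * C\<^sup>2" "4 * (norm (gradients \<theta>))\<^sup>2"]) (use main \<kappa>(1) n in \<open>auto simp: \<kappa>'_def\<close>)
qed

text \<open>The limit of \<alpha>/\<beta> activates the recursion for a fixed \<epsilon>; those of
  \<beta>^2/\<alpha> and \<alpha> put the quadratic remainders below \<alpha> r/2; small \<alpha>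
  also lets half of the contraction 2 \<alpha> \<mu> absorb the term with L^2.\<close>

lemma mse_tendsto_0:
  fixes M :: "'p measure"
  assumes noise: "iid_noise M (arcs E) p \<xi>"
    and \<alpha>: "\<And>t. 0 < \<alpha> t" "\<alpha> \<longlonglongrightarrow> 0" "\<not> summable \<alpha>"
    and \<beta>: "\<And>t. 0 < \<beta> t" "(\<lambda>t. \<alpha> t / \<beta> t) \<longlonglongrightarrow> 0" "(\<lambda>t. (\<beta> t)\<^sup>2 / \<alpha> t) \<longlonglongrightarrow> 0"
  shows "mse \<alpha> \<beta> M \<xi> x0 \<longlonglongrightarrow> 0"
proof -
  obtain \<kappa> C D where k: "0 \<le> \<kappa>" "0 \<le> C" "0 \<le> D" and
    rec: "\<And>t \<epsilon>. 0 < \<epsilon> \<Longrightarrow> \<alpha> t * \<kappa> * 2 \<le> \<beta> t * \<phi> \<epsilon> \<Longrightarrow>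
      mse \<alpha> \<beta> M \<xi> x0 (Suc t) \<le> (1 - 2 * \<alpha> t * \<mu> + 4 * (\<alpha> t)\<^sup>2 * L\<^sup>2) * mse \<alpha> \<beta> M \<xi> x0 t
        + \<alpha> t * \<kappa> * \<epsilon> + C * (\<beta> t)\<^sup>2 + D * (\<alpha> t)\<^sup>2"
    using mse_recursion[where 'p = 'p] noise \<alpha>(1) by (metis less_imp_le)
  show ?thesis
  proof (rule stochastic_recursion_tendsto_0[OF mse_nonneg \<mu>_pos])
    fix r :: real assume r: "0 < r"
    \<comment> \<open>Adding 1 covers the possible value 0 of \<kappa>.\<close>
    define \<epsilon> where "\<epsilon> = r / (2 * (\<kappa> + 1))"
    have \<epsilon>: "0 < \<epsilon>" "\<kappa> * \<epsilon> \<le> r / 2"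
      using r k by (auto simp: \<epsilon>_def field_simps)
    have "(\<lambda>t. \<alpha> t / \<beta> t * (2 * \<kappa>)) \<longlonglongrightarrow> 0 * (2 * \<kappa>)"
      by (intro tendsto_intros \<beta>)
    then have "\<forall>\<^sub>F t in sequentially. \<alpha> t / \<beta> t * (2 * \<kappa>) < \<phi> \<epsilon>"
      using phi_pos[OF \<epsilon>(1)] by (intro order_tendstoD(2)) auto
    moreover have "(\<lambda>t. C * ((\<beta> t)\<^sup>2 / \<alpha> t) + D * \<alpha> t) \<longlonglongrightarrow> C * 0 + D * 0"
      by (intro tendsto_intros \<alpha> \<beta>)
    then have "\<forall>\<^sub>F t in sequentially. C * ((\<beta> t)\<^sup>2 / \<alpha> t) + D * \<alpha> t < r / 2"
      using r by (intro order_tendstoD(2)) auto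
    moreover have "(\<lambda>t. 4 * \<alpha> t * L\<^sup>2) \<longlonglongrightarrow> 4 * 0 * L\<^sup>2"
      by (intro tendsto_intros \<alpha>)
    then have "\<forall>\<^sub>F t in sequentially. 4 * \<alpha> t * L\<^sup>2 < \<mu>"
      using \<mu>_pos by (intro order_tendstoD(2)) auto
    ultimately show "\<forall>\<^sub>F t in sequentially. mse \<alpha> \<beta> M \<xi> x0 (Suc t)
        \<le> (1 - \<alpha> t * \<mu>) * mse \<alpha> \<beta> M \<xi> x0 t + \<alpha> t * r"
    proof eventually_elim
      case (elim t)
      have "\<alpha> t * \<kappa> * 2 \<le> \<beta> t * \<phi> \<epsilon>"
        using elim(1) \<beta>(1)[of t] by (simp add: field_simps)
      note rec[OF \<epsilon>(1) this]
      moreover have "(1 - 2 * \<alpha> t * \<mu> + 4 * (\<alpha> t)\<^sup>2 * L\<^sup>2) * mse \<alpha> \<beta> M \<xi> x0 t \<le> (1 - \<alpha> t * \<mu>) * mse \<alpha> \<beta> M \<xi> x0 t"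
      proof (intro mult_right_mono mse_nonneg)
        have "\<alpha> t * (4 * \<alpha> t * L\<^sup>2) \<le> \<alpha> t * \<mu>"
          using elim(3) \<alpha>(1)[of t] by (intro mult_left_mono) auto
        then show "1 - 2 * \<alpha> t * \<mu> + 4 * (\<alpha> t)\<^sup>2 * L\<^sup>2 \<le> 1 - \<alpha> t * \<mu>"
          by (simp add: power2_eq_square algebra_simps)
      qed
      moreover have "\<alpha> t * \<kappa> * \<epsilon> + C * (\<beta> t)\<^sup>2 + D * (\<alpha> t)\<^sup>2 \<le> \<alpha> t * r"
      proof -
        have "\<alpha> t * (\<kappa> * \<epsilon> + (C * ((\<beta> t)\<^sup>2 / \<alpha> t) + D * \<alpha> t)) \<le> \<alpha> t * (r / 2 + r / 2)"
          using elim(2) \<epsilon>(2) \<alpha>(1)[of t] by (intro mult_left_mono add_mono) auto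
        then show ?thesis
          using \<alpha>(1)[of t] by (simp add: power2_eq_square algebra_simps)
      qed
      ultimately show ?case by linarith
    qed
  qed (use \<alpha> in \<open>auto intro: less_imp_le\<close>)
qed

text \<open>A single agent has no arcs, and \<open>xstar\<close> minimizes its only cost, so the
  noise, the disagreement and the gradient at \<theta> all drop out of the descent
  inequality.\<close>

lemma mse_single_node:
  fixes M :: "'p measure"
  assumes noise: "iid_noise M (arcs E) p \<xi>" and single: "CARD('n) = 1" and "arcs E = {}" and \<alpha>: "0 \<le> \<alpha> t"
  shows "mse \<alpha> \<beta> M \<xi> x0 (Suc t) \<le> (1 - 2 * \<alpha> t * \<mu> + 4 * (\<alpha> t)\<^sup>2 * L\<^sup>2) * mse \<alpha> \<beta> M \<xi> x0 t"
proof -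
  interpret prob_space M using noise by (simp add: iid_noise_def)
  let ?X = "iterate E f \<Psi> \<alpha> \<beta> \<xi> x0"
  obtain k :: 'n where k: "UNIV = {k}" using single by (metis card_1_singletonE)
  have zeros: "gradients \<theta> = 0" "coupling x v = 0" "disagreement x = 0" for x v
  proof -
    show "gradients \<theta> = 0"
      using sum_grad_eq_0 by (simp add: gradients_def \<theta>_def vec_eq_iff k) (metis UNIV_I k singletonD)
    have "neighbors E i = {}" for i using \<open>arcs E = {}\<close> by (auto simp: arcs_def neighbors_def)
    then show "coupling x v = 0" by (simp add: coupling_def vec_eq_iff)
    show "disagreement x = 0"
      using \<open>arcs E = {}\<close> by (simp add: disagreement_def)
  qed
  have pointwise: "(norm (?X (Suc t) \<omega> - \<theta>))\<^sup>2
      \<le> (1 - 2 * \<alpha> t * \<mu> + 4 * (\<alpha> t)\<^sup>2 * L\<^sup>2) * (norm (?X t \<omega> - \<theta>))\<^sup>2" for \<omega>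
  proof -
    obtain \<kappa> where "0 \<le> \<kappa>" and descent: "\<And>\<alpha> \<beta> x v. 0 \<le> \<alpha> \<Longrightarrow> (norm (step \<alpha> \<beta> x v - \<theta>))\<^sup>2
        \<le> (1 - 2 * \<alpha> * \<mu> + 4 * \<alpha>\<^sup>2 * L\<^sup>2) * (norm (x - \<theta>))\<^sup>2 - 2 * \<beta> * ((x - \<theta>) \<bullet> coupling x v)
          + 2 * \<alpha> * \<kappa> * disagreement x + 2 * \<beta>\<^sup>2 * (norm (coupling x v))\<^sup>2 + 4 * \<alpha>\<^sup>2 * (norm (gradients \<theta>))\<^sup>2"
      using step_descent by blast
    from descent[OF \<alpha>, of "\<beta> t" "?X t \<omega>" "\<lambda>e. \<xi> t e \<omega>"] zeros show ?thesis
      unfolding iterate_Suc by simp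
  qed
  note int = error_integrable[OF noise]
  show ?thesis
    unfolding mse_def using integral_mono[OF int integrable_mult_right[OF int] pointwise] by simp
qed
end

section \<open>Polynomial rates and step sizes\<close>

lemma bigo_of_contraction:
  fixes m :: "nat \<Rightarrow> real"
  assumes nonneg: "\<And>t. 0 \<le> m t" and "0 < c"
    and rec: "\<And>t. m (Suc t) \<le> (1 - 2 * c / (real t + 1) + k / (real t + 1)\<^sup>2) * m t"
  shows "m \<in> O(\<lambda>t. 1 / real t powr c)"
proof -
  \<comment> \<open>To first order the two sides are 1 - 2c/t and 1 - c/t; the gap c/t absorbs the
    term with \<open>k\<close>. Consequently \<open>m t * real t powr c\<close> is eventually
    nonincreasing.\<close>
  have "\<forall>\<^sub>F t in sequentially. 1 - 2 * c / (real t + 1) + k / (real t + 1)\<^sup>2 \<le> (real t / (real t + 1)) powr c"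
    using \<open>0 < c\<close> by real_asymp
  then obtain T where T: "1 \<le> T"
      "\<And>t. T \<le> t \<Longrightarrow> 1 - 2 * c / (real t + 1) + k / (real t + 1)\<^sup>2 \<le> (real t / (real t + 1)) powr c"
    by (metis (no_types, lifting) eventually_sequentially max.bounded_iff max.cobounded1)
  have bound: "m t * real t powr c \<le> m T * real T powr c" if "T \<le> t" for t
    using that
  proof (induction t rule: dec_induct)
    case (step t)
    have "m (Suc t) * real (Suc t) powr c \<le> ((real t / (real t + 1)) powr c * m t) * real (Suc t) powr c"
      using rec[of t] T(2)[OF step(1)] nonneg[of t]
      by (intro mult_right_mono) (auto intro: order_trans mult_right_mono)
    also have "\<dots> = m t * real t powr c"
      by (simp add: powr_divide add.commute)
    finally show ?case using step by simp
  qed simp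
  show ?thesis
  proof (rule bigoI[where c = "m T * real T powr c"])
    show "\<forall>\<^sub>F t in sequentially. norm (m t) \<le> m T * real T powr c * norm (1 / real t powr c)"
      using eventually_ge_at_top[of T]
    proof eventually_elim
      case (elim t)
      with T(1) have "0 < real t powr c" by simp
      with bound[OF elim] nonneg[of t] show ?case by (simp add: pos_le_divide_eq)
    qed
  qed
qed

lemma arcs_empty_if_single:
  fixes E :: "'n::finite set set"
  assumes "simple_graph E" and "CARD('n) = 1"
  shows "arcs E = {}"
proof -
  have "{i, j} \<notin> E" for i j :: 'n
  proof
    assume "{i, j} \<in> E"
    then have "card {i, j} = 2" using assms(1) by (simp add: simple_graph_def)
    moreover have "card {i, j} \<le> CARD('n)" by (intro card_mono) auto
    ultimately show False using assms(2) by simp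
  qed
  then show ?thesis by (auto simp: arcs_def)
qed

text \<open>The third limit rests on \<delta> < 1, the fourth on \<delta> > 1/2.\<close>

lemma step_size_limits:
  fixes a b \<delta> :: real
  assumes "0 < a" "0 < b" "1 / 2 < \<delta>" "\<delta> < 1"
  shows "(\<lambda>t. a / (real t + 1)) \<longlonglongrightarrow> 0"
    and "\<not> summable (\<lambda>t. a / (real t + 1))"
    and "(\<lambda>t. a / (real t + 1) / (b / (real t + 1) powr \<delta>)) \<longlonglongrightarrow> 0"
    and "(\<lambda>t. (b / (real t + 1) powr \<delta>)\<^sup>2 / (a / (real t + 1))) \<longlonglongrightarrow> 0"
proof -
  show "(\<lambda>t. a / (real t + 1)) \<longlonglongrightarrow> 0" by real_asymp
  show "\<not> summable (\<lambda>t. a / (real t + 1))"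
  proof
    assume "summable (\<lambda>t. a / (real t + 1))"
    then have "summable (\<lambda>t. 1 / a * (a / (real t + 1)))" by (rule summable_mult)
    then have "summable (\<lambda>t. inverse (real (Suc t)))"
      using assms by (simp add: field_simps)
    then show False
      using not_summable_harmonic[where 'a = real] summable_Suc_iff[of "\<lambda>n. inverse (real n)"] by blast
  qed
  have "(\<lambda>t. a / b * (real t + 1) powr (\<delta> - 1)) \<longlonglongrightarrow> 0"
    using assms by real_asymp
  then show "(\<lambda>t. a / (real t + 1) / (b / (real t + 1) powr \<delta>)) \<longlonglongrightarrow> 0"
    by (simp add: powr_diff mult.commute)
  have "(\<lambda>t. b\<^sup>2 / a * (real t + 1) powr (1 - 2 * \<delta>)) \<longlonglongrightarrow> 0"
    using assms by real_asymp
  moreover have "b\<^sup>2 / a * (real t + 1) powr (1 - 2 * \<delta>) = (b / (real t + 1) powr \<delta>)\<^sup>2 / (a / (real t + 1))" for t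
  proof -
    have "(real t + 1) powr (1 - 2 * \<delta>) = (real t + 1) / ((real t + 1) powr \<delta>)\<^sup>2"
      using powr_add[of "real t + 1" \<delta> \<delta>] by (simp add: powr_diff power2_eq_square)
    then show ?thesis by (simp add: power_divide)
  qed
  ultimately show "(\<lambda>t. (b / (real t + 1) powr \<delta>)\<^sup>2 / (a / (real t + 1))) \<longlonglongrightarrow> 0"
    by (simp only:)
qed

section \<open>Asymptotic bound and rate\<close>

theorem theorem1:
  fixes E :: "'n::finite set set"
    and f :: "'n \<Rightarrow> real^'m::finite \<Rightarrow> real"
    and \<mu> L :: real
    and xstar :: "real^'m"
    and p \<Psi> :: "real \<Rightarrow> real"
    and x0 :: "real^'m^'n"
  assumes "simple_graph E" and "connected_graph E"
    and "0 < \<mu>" and "\<mu> \<le> L"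
    and "\<And>i. twice_cont_differentiable (f i)"
    and "\<And>i x. loewner_le (\<mu> *\<^sub>R mat 1) (hessian (f i) x)"
    and "\<And>i x. loewner_le (hessian (f i) x) (L *\<^sub>R mat 1)"
    and "\<And>y. is_arg_min (\<lambda>x. \<Sum>i\<in>UNIV. f i x) (\<lambda>_. True) y \<longleftrightarrow> y = xstar"
    and "symmetric_noise_density p"
    and "admissible_nonlinearity \<Psi>"
  defines "\<phi> \<equiv> phi \<Psi> p"
    and "\<theta> \<equiv> (\<chi> i. xstar)"
  shows "\<exists>c1' G. 0 < c1' \<and> 0 < G \<and>
     (\<forall>u. \<bar>\<phi> u\<bar> \<le> c1') \<and>
     (\<forall>g u. G \<le> g \<longrightarrow> 0 < \<bar>u\<bar> \<longrightarrow> \<bar>u\<bar> < g \<longrightarrow> deriv \<phi> 0 * G * \<bar>u\<bar> / (2 * g) \<le> \<bar>\<phi> u\<bar>) \<and>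
     (\<forall>a b \<delta> (M :: 'p measure) \<xi>.
        0 < a \<longrightarrow> 0 < b \<longrightarrow> 1 / 2 < \<delta> \<longrightarrow> \<delta> < 1 \<longrightarrow> iid_noise M (arcs E) p \<xi> \<longrightarrow>
        (let x = iterate E f \<Psi> (\<lambda>t. a / (real t + 1)) (\<lambda>t. b / (real t + 1) powr \<delta>) \<xi> x0;
             mse = (\<lambda>t. LINT \<omega>|M. (norm (x t \<omega> - \<theta>))\<^sup>2);
             K = (norm (grad (stacked_cost f) \<theta>))\<^sup>2;
             ct = (\<lambda>t0. max (norm (x0 - \<theta>) + 2 * c1' * b * (real t0 powr (1 - \<delta>) / (1 - \<delta>)))
                            (4 * K / \<mu>\<^sup>2 + mse t0));
             B = (\<lambda>t0. 256 * a\<^sup>2 * c1'\<^sup>2 * (real CARD('m) * real CARD('n) - 1) * (L * ct t0 + K)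
                        / ((1 - \<delta>) * deriv \<phi> 0 * G)\<^sup>2 * (1 + 4 * (L / \<mu>)));
             \<gamma> = min (deriv \<phi> 0 * G * (1 - \<delta>) / (4 * c1')) (a * \<mu>)
         in (\<exists>t0. \<forall>t. mse t \<le> ct t0) \<and>
            (\<forall>t0. (\<forall>t. mse t \<le> ct t0) \<longrightarrow>
               limsup (\<lambda>t. ereal (mse t)) \<le> ereal (B t0) \<and>
               (\<exists>r \<in> O(\<lambda>t. 1 / real t powr \<gamma>). \<forall>t. mse t \<le> B t0 + r t))))"
proof -
  interpret robust_nonlinearity p \<Psi>
    using assms by unfold_locales
  have argmin: "is_arg_min (\<lambda>x. \<Sum>i\<in>UNIV. f i x) (\<lambda>_. True) xstar"
    using assms(8) by blast
  interpret net: noisy_network p \<Psi> E f \<mu> L xstar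
  proof (intro noisy_network.intro noisy_network_axioms.intro robust_nonlinearity_axioms convex_cost.intro)
    show "(\<Sum>i\<in>UNIV. f i xstar) \<le> (\<Sum>i\<in>UNIV. f i y)" for y
      using argmin unfolding is_arg_min_def not_less[symmetric] by blast
  qed (use assms in auto)
  have \<theta>: "\<theta> = net.\<theta>" by (simp add: \<theta>_def net.\<theta>_def)
  \<comment> \<open>This bound of \<Psi> becomes \<open>c1'\<close>; like \<open>G\<close>, it is
    fixed before the step sizes and the noise.\<close>
  obtain c where c: "0 < c" "\<And>u. \<bar>\<Psi> u\<bar> \<le> c" using \<Psi>_bounded by blast
  obtain G where G: "0 < G"
      "\<And>g u. G \<le> g \<Longrightarrow> \<bar>u\<bar> < g \<Longrightarrow> deriv (phi \<Psi> p) 0 * G * \<bar>u\<bar> / (2 * g) \<le> \<bar>phi \<Psi> p u\<bar>"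
    using phi_linear_bound by blast
  let ?D = "deriv (phi \<Psi> p) 0"
  \<comment> \<open>The local abbreviations of the statement become variables with defining
    equations, which are later discharged by reflexivity.\<close>
  have main: "(\<exists>t0. \<forall>t. m t \<le> ct t0) \<and>
      (\<forall>t0. (\<forall>t. m t \<le> ct t0) \<longrightarrow>
        limsup (\<lambda>t. ereal (m t)) \<le> ereal (B t0) \<and>
        (\<exists>r \<in> O(\<lambda>t. 1 / real t powr \<gamma>). \<forall>t. m t \<le> B t0 + r t))"
    if ab: "0 < a" "0 < b" "1 / 2 < \<delta>" "\<delta> < 1" and noise: "iid_noise M (arcs E) p \<xi>"
      and m: "m = (\<lambda>t. LINT \<omega>|M. (norm (iterate E f \<Psi> (\<lambda>t. a / (real t + 1)) (\<lambda>t. b / (real t + 1) powr \<delta>) \<xi> x0 t \<omega> - \<theta>))\<^sup>2)"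
      and K: "K = (norm (grad (stacked_cost f) \<theta>))\<^sup>2"
      and ct: "ct = (\<lambda>t0. max (norm (x0 - \<theta>) + 2 * c * b * (real t0 powr (1 - \<delta>) / (1 - \<delta>))) (4 * K / \<mu>\<^sup>2 + m t0))"
      and B: "B = (\<lambda>t0. 256 * a\<^sup>2 * c\<^sup>2 * (real CARD('m) * real CARD('n) - 1) * (L * ct t0 + K)
                        / ((1 - \<delta>) * ?D * G)\<^sup>2 * (1 + 4 * (L / \<mu>)))"
      and \<gamma>: "\<gamma> = min (?D * G * (1 - \<delta>) / (4 * c)) (a * \<mu>)"
    for a b \<delta> :: real and M :: "'p measure" and \<xi> m K ct B \<gamma>
  proof -
    let ?\<alpha> = "\<lambda>t. a / (real t + 1)" and ?\<beta> = "\<lambda>t. b / (real t + 1) powr \<delta>"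
    have m_mse: "m = net.mse ?\<alpha> ?\<beta> M \<xi> x0"
      by (simp add: m net.mse_def \<theta> fun_eq_iff)
    have nonneg: "0 \<le> m t" for t
      unfolding m_mse by (rule net.mse_nonneg)
    have lim: "m \<longlonglongrightarrow> 0"
      unfolding m_mse using ab noise step_size_limits[OF ab] by (intro net.mse_tendsto_0) auto
    have "\<exists>t0. \<forall>t. m t \<le> ct t0"
    proof -
      obtain R where R: "\<And>t. norm (m t) \<le> R"
        using convergent_imp_Bseq[of m] lim by (auto simp: convergent_def Bseq_def)
      \<comment> \<open>The first entry of the maximum grows without bound in \<open>t0\<close>, so
        it eventually exceeds any bound of the convergent sequence \<open>m\<close>.\<close>
      have "filterlim (\<lambda>t. 2 * c * b * (real t powr (1 - \<delta>) / (1 - \<delta>))) at_top sequentially"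
        using ab c by real_asymp
      then obtain t0 where "R \<le> 2 * c * b * (real t0 powr (1 - \<delta>) / (1 - \<delta>))"
        by (auto simp: filterlim_at_top eventually_sequentially)
      then have "R \<le> ct t0"
        unfolding ct by (simp add: le_max_iff_disj add_increasing)
      moreover have "m t \<le> R" for t using R[of t] by simp
      ultimately show ?thesis by (meson order_trans)
    qed
    moreover have "limsup (\<lambda>t. ereal (m t)) \<le> ereal (B t0) \<and> (\<exists>r \<in> O(\<lambda>t. 1 / real t powr \<gamma>). \<forall>t. m t \<le> B t0 + r t)"
      if le: "\<forall>t. m t \<le> ct t0" for t0
    proof
      have K0: "0 \<le> K" and ct0: "0 \<le> ct t0" and L0: "0 < L"
        using le nonneg[of 0] net.L_pos by (auto simp: K intro: order_trans)
      have MN: "1 \<le> CARD('m)" "1 \<le> CARD('n)"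
        by (simp_all add: Suc_le_eq)
      then have MN': "1 \<le> real CARD('m) * real CARD('n)"
        by (metis mult_le_mono nat_mult_1 of_nat_1 of_nat_le_iff of_nat_mult)
      have den: "0 < ((1 - \<delta>) * ?D * G)\<^sup>2" "0 < 1 + 4 * (L / \<mu>)"
        using ab phi_deriv_pos G L0 net.\<mu>_pos by (auto intro!: add_pos_pos)
      have B0: "0 \<le> B t0"
        unfolding B using K0 ct0 L0 MN' den by simp
      have "limsup (\<lambda>t. ereal (m t)) = 0"
        using lim by (intro lim_imp_Limsup) (auto simp: zero_ereal_def)
      then show "limsup (\<lambda>t. ereal (m t)) \<le> ereal (B t0)"
        using B0 by simp
      \<comment> \<open>Only the factors MN - 1 and L c~ + K of the bound can vanish, and the second
        is positive once c~ is nonzero.\<close>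
      consider "0 < B t0" | "B t0 = 0" "CARD('m) * CARD('n) = 1" | "ct t0 = 0"
      proof (cases "CARD('m) * CARD('n) = 1 \<or> ct t0 = 0")
        case True
        then have "B t0 = 0" if "ct t0 \<noteq> 0"
          unfolding B using that by (simp flip: of_nat_mult)
        with True that show thesis by blast
      next
        case False
        then have "1 < CARD('m) * CARD('n)" using MN by (simp add: order.strict_iff_order)
        then have "1 < real CARD('m) * real CARD('n)" by (metis of_nat_1 of_nat_less_iff of_nat_mult)
        moreover have "0 < L * ct t0 + K" using False ct0 L0 K0 by (simp add: add_pos_nonneg)
        ultimately have "0 < B t0"
          unfolding B using den ab c by (intro mult_pos_pos divide_pos_pos) auto
        then show thesis by (rule that)
      qed
      then show "\<exists>r \<in> O(\<lambda>t. 1 / real t powr \<gamma>). \<forall>t. m t \<le> B t0 + r t"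
      proof cases
        case 1
        \<comment> \<open>The error falls below the positive bound, so its excess is eventually 0
          and thus of any order.\<close>
        have ev: "\<forall>\<^sub>F t in sequentially. max 0 (m t - B t0) = 0"
          using order_tendstoD(2)[OF lim 1] by (rule eventually_mono) simp
        show ?thesis
        proof
          show "(\<lambda>t. max 0 (m t - B t0)) \<in> O(\<lambda>t. 1 / real t powr \<gamma>)"
            using landau_o.big.in_cong[OF ev] by simp
        qed auto
      next
        case 2
        then have single: "CARD('n) = 1" by simp
        have "m \<in> O(\<lambda>t. 1 / real t powr (a * \<mu>))"
        proof (rule bigo_of_contraction[OF nonneg])
          show "0 < a * \<mu>" using ab net.\<mu>_pos by simp
          show "m (Suc t) \<le> (1 - 2 * (a * \<mu>) / (real t + 1) + 4 * a\<^sup>2 * L\<^sup>2 / (real t + 1)\<^sup>2) * m t" for t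
            using net.mse_single_node[OF noise single arcs_empty_if_single[OF assms(1) single], of ?\<alpha> t ?\<beta> x0] ab
            by (simp add: m_mse power_divide mult_ac)
        qed
        \<comment> \<open>Since \<gamma> is a minimum with \<open>a * \<mu>\<close> as one entry,
          the rate just found is at least as fast.\<close>
        also have "(\<lambda>t. 1 / real t powr (a * \<mu>)) \<in> O(\<lambda>t. 1 / real t powr \<gamma>)"
        proof (rule bigoI[where c = 1])
          show "\<forall>\<^sub>F t in sequentially. norm (1 / real t powr (a * \<mu>)) \<le> 1 * norm (1 / real t powr \<gamma>)"
            using eventually_ge_at_top[of 1]
          proof eventually_elim
            case (elim t)
            then have "real t powr \<gamma> \<le> real t powr (a * \<mu>)" by (intro powr_mono) (auto simp: \<gamma>)
            with elim show ?case by (simp add: frac_le)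
          qed
        qed
        finally show ?thesis using 2 by auto
      next
        case 3
        \<comment> \<open>Here the hypothesis on \<open>t0\<close> already forces every error to be
          at most 0.\<close>
        have "m t \<le> B t0 + 0" for t
          using le 3 B0 by (metis add.right_neutral order_trans)
        then show ?thesis
          by (intro bexI[of _ "\<lambda>_. 0"]) auto
      qed
    qed
    ultimately show ?thesis by blast
  qed
  show ?thesis
    unfolding Let_def \<phi>_def
  proof (rule exI[of _ c], rule exI[of _ G], intro conjI)
    show "\<forall>u. \<bar>phi \<Psi> p u\<bar> \<le> c"
      using phi_bounded c by blast
    show "\<forall>g u. G \<le> g \<longrightarrow> 0 < \<bar>u\<bar> \<longrightarrow> \<bar>u\<bar> < g \<longrightarrow> ?D * G * \<bar>u\<bar> / (2 * g) \<le> \<bar>phi \<Psi> p u\<bar>"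
      using G(2) by blast
  qed (rule c G | intro allI impI, rule main[OF _ _ _ _ _ refl refl refl refl refl]; assumption)+
qed

end
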